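(* Let $\mathcal R$ be a (unital) Banach algebra and suppose $f:Y_0\to\mathcal R$ is Hahn holomorphic and $f(z)$ is invertible for all $z\in Y_0$. Then $z\mapsto f(z)^{-1}$ is also Hahn holomorphic on $Y_0$.
   Context: Logarithmic cover. $\mathcal Z$ is the logarithmic covering surface of $\mathbb C\setminus\{0\}$ with global polar coordinates $(r,\varphi)\in(0,\infty)\times\mathbb R$; for $z=(r,\varphi)$ write $|z|=r$, $\arg z=\varphi$. $\mathcal Z_0=\mathcal Z\cup\{0\}$ carries the topology generated by the open sets of $\mathcal Z$ and the discs $D_\epsilon=\{0\}\cup\{z\in\mathcal Z: |z|<\epsilon\}$. The positive real axis is identified with $\{z\in\mathcal Z:\arg z=0\}$. $Y\subset\mathcal Z$ is an open set containing an interval $(0,\delta)$ for some $\delta>0$, and $Y_0=Y\cup\{0\}$. Exponents. $(\Gamma,+)$ is a linearly ordered abelian group, $\Gamma^+=\{\gamma\in\Gamma:\gamma>0\}$, $\Gamma^+_0=\Gamma^+\cup\{0\}$. $\gamma\mapsto e_\gamma$ is a group homomorphism from $\Gamma$ to the multiplicative group of nowhere vanishing holomorphic functions on $Y$, such that for every $\gamma>0$ the function $e_\gamma$ is bounded on $Y$ and $\lim_{z\to0}|e_\gamma(z)|=0$. Put $\|e_\gamma\|_{Y,\epsilon}=\sup_{z\in Y\cap D_\epsilon}|e_\gamma(z)|$. Hahn series. A Hahn series with coefficients in $\mathcal R$ is a formal series $\mathfrak h=\sum_{\gamma\in\Gamma}a_\gamma e_\gamma$, $a_\gamma\in\mathcal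 R$, whose support $\{\gamma: a_\gamma\ne0\}$ is well-ordered. For normed $\mathcal R$, it is normally convergent in $Y\cap D_\epsilon$ if its support is countable and $\sum_\gamma\|a_\gamma\|\,\|e_\gamma\|_{Y,\epsilon}<\infty$. Admissibility. For $S\subset\Gamma_0^+$, a family $\{e_\alpha\}_{\alpha\in S}$ is weakly monotonous if there is $r_S>0$ such that for every $x\in(0,r_S)$ there is $\rho(x)$ with $0<\rho(x)\le x$ and $\|e_\alpha\|_{Y,\rho(x)}\le|e_\alpha(x)|$ for all $\alpha\in S$. A (well-ordered) set $S\subset\Gamma^+_0$ is admissible if $\{e_\alpha\}_{\alpha\in S}$ is weakly monotonous and for every nonempty $B\subset S$ the family $\{e_{\alpha-\min B}\}_{\alpha\in S,\ \alpha>\min B}$ is weakly monotonous. Hahn holomorphic. A continuous function $h:Y_0\to\mathcal R$ ($\mathcal R$ a Banach algebra), holomorphic in $Y$, is Hahn holomorphic if there is a Hahn series $\sum_\gamma a_\gamma e_\gamma$ with countable admissible support (contained in $\Gamma_0^+$), converging normally on $Y\cap D_\delta$ for some $\delta>0$, with $h(z)=\sum_\gamma a_\gamma e_\gamma(z)$ for $z\in Y\cap D_\delta$. *)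

theory Defs
  imports "HOL-Analysis.Analysis"
begin

text \<open>The library's Banach algebras are real; this adds a compatible complex scalar
  multiplication.  As in \<open>real_normed_algebra_1\<close>, the unit has norm 1.\<close>

class complex_banach_algebra_1 = real_normed_algebra_1 + banach +
  fixes scaleC :: "complex \<Rightarrow> 'a \<Rightarrow> 'a"  (infixr "*\<^sub>C" 75)
  assumes scaleC_add_right: "c *\<^sub>C (x + y) = c *\<^sub>C x + c *\<^sub>C y"
    and scaleC_add_left: "(c + d) *\<^sub>C x = c *\<^sub>C x + d *\<^sub>C x"
    and scaleC_scaleC: "c *\<^sub>C (d *\<^sub>C x) = (c * d) *\<^sub>C x"
    and scaleC_of_real: "complex_of_real r *\<^sub>C x = r *\<^sub>R x"
    and mult_scaleC_left: "(c *\<^sub>C x) * y = c *\<^sub>C (x * y)"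
    and mult_scaleC_right: "x * (c *\<^sub>C y) = c *\<^sub>C (x * y)"
    and norm_scaleC: "norm (c *\<^sub>C x) = cmod c * norm x"

instantiation complex :: complex_banach_algebra_1
begin

definition scaleC_complex :: "complex \<Rightarrow> complex \<Rightarrow> complex"
  where "scaleC_complex c x = c * x"

instance
  by standard
    (auto simp: scaleC_complex_def algebra_simps norm_mult scaleR_conv_of_real)

end

definition is_inverse_of :: "'a::monoid_mult \<Rightarrow> 'a \<Rightarrow> bool"
  where "is_inverse_of x y \<longleftrightarrow> x * y = 1 \<and> y * x = 1"

definition invertible_elem :: "'a::monoid_mult \<Rightarrow> bool"
  where "invertible_elem x \<longleftrightarrow> (\<exists>y. is_inverse_of x y)"

definition inverse_elem :: "'a::monoid_mult \<Rightarrow> 'a"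
  where "inverse_elem x = (THE y. is_inverse_of x y)"


section \<open>The logarithmic cover\<close>

text \<open>Points are pairs of polar coordinates.  The added point 0 is encoded as \<open>(0, 0)\<close>.\<close>

type_synonym lpoint = "real \<times> real"

definition logcover :: "lpoint set"
  where "logcover = {0<..} \<times> UNIV"

definition lzero :: lpoint
  where "lzero = (0, 0)"

definition ldisc :: "real \<Rightarrow> lpoint set"
  where "ldisc \<epsilon> = insert lzero {z \<in> logcover. fst z < \<epsilon>}"

text \<open>On the cover with 0 added, this is strictly coarser at 0 than the subspace topology
  of the plane, since the discs contain points of arbitrarily large argument.\<close>

definition logcover0_topology :: "lpoint topology"
  where "logcover0_topology =
    topology_generated_by ({U. open U \<and> U \<subseteq> logcover} \<union> {ldisc \<epsilon> |\<epsilon>. \<epsilon> > 0})"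

definition posreal :: "real \<Rightarrow> lpoint"
  where "posreal x = (x, 0)"

definition lproj :: "lpoint \<Rightarrow> complex"
  where "lproj z = rcis (fst z) (snd z)"

text \<open>The complex structure of the cover is the one that makes the covering projection
  locally biholomorphic, so the difference quotient is taken with respect to the local
  coordinate \<open>lproj\<close>, which is injective near each point of the cover.\<close>

definition lholomorphic_on ::
    "(lpoint \<Rightarrow> 'a::complex_banach_algebra_1) \<Rightarrow> lpoint set \<Rightarrow> bool"
  where "lholomorphic_on h Y \<longleftrightarrow>
    (\<forall>z\<in>Y. \<exists>D. ((\<lambda>w. inverse (lproj w - lproj z) *\<^sub>C (h w - h z)) \<longlongrightarrow> D) (at z within Y))"

definition log_domain :: "lpoint set \<Rightarrow> bool"
  where "log_domain Y \<longleftrightarrow> open Y \<and> Y \<subseteq> logcover \<and> (\<exists>\<delta>>0. posreal ` {0<..<\<delta>} \<subseteq> Y)"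


section \<open>Exponents and Hahn series\<close>

definition exponent_hom ::
    "lpoint set \<Rightarrow> ('g::linordered_ab_group_add \<Rightarrow> lpoint \<Rightarrow> complex) \<Rightarrow> bool"
  where "exponent_hom Y e \<longleftrightarrow>
    (\<forall>\<gamma>. lholomorphic_on (e \<gamma>) Y \<and> (\<forall>z\<in>Y. e \<gamma> z \<noteq> 0)) \<and>
    (\<forall>\<gamma> \<gamma>'. \<forall>z\<in>Y. e (\<gamma> + \<gamma>') z = e \<gamma> z * e \<gamma>' z) \<and>
    (\<forall>\<gamma>>0. bounded (e \<gamma> ` Y) \<and>
      ((\<lambda>z. cmod (e \<gamma> z)) \<longlongrightarrow> 0) (atin_within logcover0_topology lzero Y))"

text \<open>The supremum is taken in the reals, so it is meaningful only if \<open>e \<gamma>\<close> is bounded on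
  \<open>Y \<inter> ldisc \<epsilon>\<close>, as is the case for nonnegative \<open>\<gamma>\<close>.\<close>

definition esup ::
    "lpoint set \<Rightarrow> ('g \<Rightarrow> lpoint \<Rightarrow> complex) \<Rightarrow> real \<Rightarrow> 'g \<Rightarrow> real"
  where "esup Y e \<epsilon> \<gamma> = (SUP z\<in>Y \<inter> ldisc \<epsilon>. cmod (e \<gamma> z))"

definition well_ordered_set :: "'g::linorder set \<Rightarrow> bool"
  where "well_ordered_set S \<longleftrightarrow> (\<forall>B\<subseteq>S. B \<noteq> {} \<longrightarrow> (\<exists>m\<in>B. \<forall>b\<in>B. m \<le> b))"

text \<open>A formal series is given by its family of coefficients.\<close>

definition hahn_support :: "('g \<Rightarrow> 'a::zero) \<Rightarrow> 'g set"
  where "hahn_support a = {\<gamma>. a \<gamma> \<noteq> 0}"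

definition hahn_series :: "('g::linorder \<Rightarrow> 'a::zero) \<Rightarrow> bool"
  where "hahn_series a \<longleftrightarrow> well_ordered_set (hahn_support a)"

text \<open>The boundedness clause says that the suprema occurring in the sum are finite.\<close>

definition normally_convergent ::
    "lpoint set \<Rightarrow> ('g \<Rightarrow> lpoint \<Rightarrow> complex) \<Rightarrow> real \<Rightarrow> ('g \<Rightarrow> 'a::real_normed_vector) \<Rightarrow> bool"
  where "normally_convergent Y e \<epsilon> a \<longleftrightarrow>
    countable (hahn_support a) \<and>
    (\<forall>\<gamma>\<in>hahn_support a. bounded (e \<gamma> ` (Y \<inter> ldisc \<epsilon>))) \<and>
    (\<lambda>\<gamma>. norm (a \<gamma>) * esup Y e \<epsilon> \<gamma>) summable_on hahn_support a"

text \<open>Since \<open>r\<close> can be decreased, it does no harm that \<open>posreal x \<in> Y\<close> is not demanded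
  here: it holds for small \<open>x\<close> by \<open>log_domain\<close>.\<close>

definition weakly_monotonous ::
    "lpoint set \<Rightarrow> ('g \<Rightarrow> lpoint \<Rightarrow> complex) \<Rightarrow> 'g set \<Rightarrow> bool"
  where "weakly_monotonous Y e S \<longleftrightarrow>
    (\<exists>r>0. \<forall>x. 0 < x \<and> x < r \<longrightarrow>
      (\<exists>\<rho>. 0 < \<rho> \<and> \<rho> \<le> x \<and> (\<forall>\<alpha>\<in>S. esup Y e \<rho> \<alpha> \<le> cmod (e \<alpha> (posreal x)))))"

definition admissible_set ::
    "lpoint set \<Rightarrow> ('g::linordered_ab_group_add \<Rightarrow> lpoint \<Rightarrow> complex) \<Rightarrow> 'g set \<Rightarrow> bool"
  where "admissible_set Y e S \<longleftrightarrow>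
    S \<subseteq> {0..} \<and> well_ordered_set S \<and> weakly_monotonous Y e S \<and>
    (\<forall>B\<subseteq>S. B \<noteq> {} \<longrightarrow>
      (let m = (LEAST b. b \<in> B) in weakly_monotonous Y e {\<alpha> - m |\<alpha>. \<alpha> \<in> S \<and> \<alpha> > m}))"

definition hahn_holomorphic ::
    "lpoint set \<Rightarrow> ('g::linordered_ab_group_add \<Rightarrow> lpoint \<Rightarrow> complex) \<Rightarrow>
      (lpoint \<Rightarrow> 'a::complex_banach_algebra_1) \<Rightarrow> bool"
  where "hahn_holomorphic Y e h \<longleftrightarrow>
    continuous_map (subtopology logcover0_topology (insert lzero Y)) euclidean h \<and>
    lholomorphic_on h Y \<and>
    (\<exists>a. hahn_series a \<and> countable (hahn_support a) \<and> admissible_set Y e (hahn_support a) \<and>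
      (\<exists>\<delta>>0. normally_convergent Y e \<delta> a \<and>
        (\<forall>z\<in>Y \<inter> ldisc \<delta>. ((\<lambda>\<gamma>. e \<gamma> z *\<^sub>C a \<gamma>) has_sum h z) (hahn_support a))))"

end

(* Write f = a_0 (1 - g), where a_0 = f(0) is invertible and g has small norm near 0. There
   f^-1 = (1 + g + g^2 + ...) a_0^-1, and expanding the Neumann series indexes it by the words over
   the support S of f; collecting words with equal sum gives a normally convergent Hahn series
   supported in the monoid generated by S. That this monoid is again well-ordered and admissible
   follows from Higman's lemma: any set of words over S has a finite basis for the embedding order,
   so the uniform estimates that admissibility demands reduce to finitely many of those known for S,
   combined by multiplicativity of the exponents. *)

theory Submission
  imports Defs "HOL-Library.Sublist"
begin

section \<open>Words over a well-ordered set\<close>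


text \<open>The obstacle is admissibility rather than convergence. Weak monotonicity asks for one
  radius \<rho>(x) that serves all exponents of a family at once. This passes to finite unions and
  to generated monoids, but the infimum of infinitely many radii may be 0. Admissibility of the
  monoid concerns differences \<alpha> - m in which both \<alpha> and m are sums of words, whereas
  the hypothesis knows differences s - t of elements of S, one family for each t. Splitting \<alpha>
  - m into (sum u - m) + (\<alpha> - sum u), with u a basis word embedded in a word for \<alpha>,
  leaves only letters of u as subtrahends, hence finitely many t. The expansion of f is given on Y,
  which does not contain 0, so a_0 = f(0) has to be obtained from continuity at 0; its invertibility
  is then the hypothesis at that point. The coefficients need not commute: the series is summed over
  words instead of multi-indices, and its sum is shown to be an inverse on one side, which suffices
  because f(z) is known to be invertible.\<close>

lemma well_ordered_set_subset:
  "well_ordered_set S \<Longrightarrow> T \<subseteq> S \<Longrightarrow> well_ordered_set T"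
  unfolding well_ordered_set_def by (meson subset_trans)

text \<open>Every tail of the sequence attains its minimum; the positions of successive tail minima
  form the subsequence.\<close>

lemma well_ordered_set_mono_subseq:
  fixes x :: "nat \<Rightarrow> 'g::linorder"
  assumes "well_ordered_set S" "\<And>i. x i \<in> S"
  obtains \<phi> :: "nat \<Rightarrow> nat" where "strict_mono \<phi>" "\<And>i j. i \<le> j \<Longrightarrow> x (\<phi> i) \<le> x (\<phi> j)"
proof -
  have min: "\<exists>m>k. \<forall>j>k. x m \<le> x j" for k
  proof -
    have "x ` {k<..} \<subseteq> S" "x ` {k<..} \<noteq> {}" using assms(2) by auto
    then obtain m where "m \<in> x ` {k<..}" "\<forall>b\<in>x ` {k<..}. m \<le> b"
      using assms(1) unfolding well_ordered_set_def by meson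
    then show ?thesis by auto
  qed
  have "\<exists>\<phi>. \<forall>n. (\<forall>j\<ge>\<phi> n. x (\<phi> n) \<le> x j) \<and> \<phi> n < \<phi> (Suc n)"
  proof (rule dependent_nat_choice)
    show "\<exists>k. \<forall>j\<ge>k. x k \<le> x j" using min[of 0] by (meson less_le_trans)
  next
    fix k n :: nat
    show "\<exists>m. (\<forall>j\<ge>m. x m \<le> x j) \<and> k < m" using min[of k] by (meson less_le_trans)
  qed
  then obtain \<phi> :: "nat \<Rightarrow> nat" where \<phi>: "\<And>n j. j \<ge> \<phi> n \<Longrightarrow> x (\<phi> n) \<le> x j" "\<And>n. \<phi> n < \<phi> (Suc n)"
    by blast
  have "strict_mono \<phi>" using \<phi>(2) by (simp add: strict_mono_Suc_iff)
  then show thesis using \<phi>(1) that by (meson strict_mono_less_eq)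
qed

text \<open>Nash-Williams' argument with a minimal bad sequence.\<close>

lemma higman:
  fixes f :: "nat \<Rightarrow> 'g::linorder list"
  assumes wo: "well_ordered_set S" and f: "\<And>i. f i \<in> lists S"
  shows "\<exists>i j. i < j \<and> list_emb (\<le>) (f i) (f j)"
proof (rule ccontr)
  define bad where "bad h \<longleftrightarrow> (\<forall>i. h i \<in> lists S) \<and> (\<forall>i j. i < j \<longrightarrow> \<not> list_emb (\<le>) (h i) (h j))"
    for h :: "nat \<Rightarrow> 'g list"
  assume "\<not> ?thesis"
  then have bad_f: "bad f" using f unfolding bad_def by blast
  define minimal where "minimal n h \<longleftrightarrow>
    bad h \<and> (\<forall>h'. bad h' \<and> (\<forall>i<n. h' i = h i) \<longrightarrow> length (h n) \<le> length (h' n))" for n h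
  have minimal_ex: "\<exists>h'. minimal n h' \<and> (\<forall>i<n. h' i = h i)" if "bad h" for n h
  proof -
    let ?P = "\<lambda>h'. bad h' \<and> (\<forall>i<n. h' i = h i)"
    have "?P h" using that by simp
    from exists_least_iff[THEN iffD1, of "\<lambda>k. \<exists>h'. ?P h' \<and> length (h' n) = k"] this
    obtain h' where "?P h'" "\<And>h''. ?P h'' \<Longrightarrow> length (h' n) \<le> length (h'' n)"
      by (metis (no_types, lifting) linorder_not_less)
    then show ?thesis unfolding minimal_def by (intro exI[of _ h']) auto
  qed
  \<comment> \<open>\<open>F (Suc n)\<close> is minimised at position n + 1 and keeps the entries of
    \<open>F n\<close> up to n, so the entries stabilise. The diagonal \<open>g\<close> below agrees
    with \<open>F n\<close> up to n; every pair i < j of its entries therefore occurs in the bad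
    sequence \<open>F j\<close>.\<close>
  have "\<exists>F. \<forall>n. minimal n (F n) \<and> (\<forall>i<Suc n. F (Suc n) i = F n i)"
    by (rule dependent_nat_choice)
      (use minimal_ex[OF bad_f, of 0] minimal_ex in \<open>auto simp: minimal_def\<close>)
  then obtain F where F: "\<And>n. minimal n (F n)" "\<And>n i. i \<le> n \<Longrightarrow> F (Suc n) i = F n i"
    by (auto simp: less_Suc_eq_le)
  define g where "g n = F n n" for n
  have F_g: "F n i = g i" if "i \<le> n" for n i
    using that by (induction n rule: dec_induct) (auto simp: g_def F)
  have "bad g" unfolding bad_def
  proof (intro conjI allI impI)
    show "g i \<in> lists S" for i using F(1)[of i] unfolding g_def minimal_def bad_def by blast
    show "\<not> list_emb (\<le>) (g i) (g j)" if "i < j" for i j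
      using F(1)[of j] that F_g[of i j] F_g[of j j] unfolding minimal_def bad_def
      by (metis less_imp_le order_refl)
  qed
  then have g: "\<And>i. g i \<in> lists S" "\<And>i j. i < j \<Longrightarrow> \<not> list_emb (\<le>) (g i) (g j)"
    unfolding bad_def by blast+
  have nonempty: "g i \<noteq> []" for i using g(2)[of i "Suc i"] by auto
  define x y where "x i = hd (g i)" and "y i = tl (g i)" for i
  have g_xy: "g i = x i # y i" for i using nonempty[of i] by (simp add: x_def y_def)
  have x_S: "x i \<in> S" and y_S: "y i \<in> lists S" for i using g(1)[of i] unfolding g_xy by auto
  obtain \<phi> :: "nat \<Rightarrow> nat" where \<phi>: "strict_mono \<phi>" "\<And>i j. i \<le> j \<Longrightarrow> x (\<phi> i) \<le> x (\<phi> j)"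
    using well_ordered_set_mono_subseq[of S x] wo x_S by blast
  \<comment> \<open>\<open>h\<close> follows \<open>g\<close> up to the first selected position and
    then runs through the tails of the selected words. An embedding inside \<open>h\<close> lifts to
    one inside \<open>g\<close>: a tail embeds in its own word, and two tails get their heads back
    because the heads increase along \<phi>. So \<open>h\<close> is bad, although its entry at
    \<open>k\<close> is the tail of \<open>g k\<close> and hence shorter.\<close>
  define k h where "k = \<phi> 0" and "h i = (if i < k then g i else y (\<phi> (i - k)))" for i
  have "bad h" unfolding bad_def
  proof (intro conjI allI impI notI)
    show "h i \<in> lists S" for i using g(1) y_S by (simp add: h_def)
    fix i j :: nat assume ij: "i < j" and emb: "list_emb (\<le>) (h i) (h j)"
    consider "j < k" | "i < k" "k \<le> j" | "k \<le> i" by linarith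
    then show False
    proof cases
      case 1 then show False using emb ij g(2) by (simp add: h_def)
    next
      case 2
      then have "list_emb (\<le>) (g i) (g (\<phi> (j - k)))"
        using emb by (auto simp: h_def g_xy[of "\<phi> (j - k)"])
      moreover have "i < \<phi> (j - k)"
        using 2 \<phi>(1) unfolding k_def by (meson le0 less_le_trans strict_mono_less_eq)
      ultimately show False using g(2) by blast
    next
      case 3
      then have "list_emb (\<le>) (g (\<phi> (i - k))) (g (\<phi> (j - k)))"
        using emb ij \<phi>(2) by (auto simp: h_def g_xy)
      moreover have "\<phi> (i - k) < \<phi> (j - k)"
        using 3 ij \<phi>(1) by (simp add: strict_mono_less diff_less_mono)
      ultimately show False using g(2) by blast
    qed
  qed
  moreover have "\<forall>i<k. h i = F k i" by (simp add: h_def F_g)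
  ultimately have "length (F k k) \<le> length (h k)" using F(1)[of k] unfolding minimal_def by blast
  then show False using g_xy[of k] by (simp add: F_g h_def k_def)
qed

text \<open>Without a finite basis one could keep choosing words of \<open>U\<close> into which no
  earlier choice embeds, against \<open>higman\<close>.\<close>

lemma list_emb_finite_basis:
  fixes U :: "'g::linorder list set"
  assumes wo: "well_ordered_set S" and U: "U \<subseteq> lists S"
  obtains B where "finite B" "B \<subseteq> U" "\<And>w. w \<in> U \<Longrightarrow> \<exists>u\<in>B. list_emb (\<le>) u w"
proof -
  have "\<exists>B. finite B \<and> B \<subseteq> U \<and> (\<forall>w\<in>U. \<exists>u\<in>B. list_emb (\<le>) u w)"
  proof (rule ccontr)
    assume neg: "\<not> ?thesis"
    have next_ex: "\<exists>w\<in>U. \<forall>u\<in>B. \<not> list_emb (\<le>) u w" if "finite B" "B \<subseteq> U" for B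
    proof -
      from neg have "\<not> (finite B \<and> B \<subseteq> U \<and> (\<forall>w\<in>U. \<exists>u\<in>B. list_emb (\<le>) u w))" by (rule contrapos_nn) (rule exI)
      then show ?thesis using that by simp
    qed
    have "\<exists>f. \<forall>n::nat. f n \<in> U \<and> (\<forall>i<n. \<not> list_emb (\<le>) (f i) (f n))"
    proof (rule dependent_wellorder_choice)
      fix n and f :: "nat \<Rightarrow> 'g list"
      assume "\<And>i. i < n \<Longrightarrow> f i \<in> U \<and> (\<forall>j<i. \<not> list_emb (\<le>) (f j) (f i))"
      then show "\<exists>r. r \<in> U \<and> (\<forall>i<n. \<not> list_emb (\<le>) (f i) r)"
        using next_ex[of "f ` {..<n}"] by fastforce
    qed auto
    then obtain f :: "nat \<Rightarrow> _" where "\<And>n. f n \<in> U" "\<And>i n. i < n \<Longrightarrow> \<not> list_emb (\<le>) (f i) (f n)"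
      by blast
    then show False using higman[OF wo, of f] U by blast
  qed
  then show thesis using that by blast
qed

text \<open>The submonoid generated by \<open>A\<close>, encoded as an image of words so that
  statements about words, such as finite bases and sums over all words, carry over along
  \<open>sum_list\<close>.\<close>

definition gen_monoid :: "'g::monoid_add set \<Rightarrow> 'g set"
  where "gen_monoid A = sum_list ` lists A"

lemma gen_monoid_mono: "A \<subseteq> B \<Longrightarrow> gen_monoid A \<subseteq> gen_monoid B"
  unfolding gen_monoid_def by (meson image_mono lists_mono)

lemma gen_monoid_zero: "0 \<in> gen_monoid A"
  unfolding gen_monoid_def by (rule image_eqI[of _ _ "[]"]) auto

lemma gen_monoid_incl: "x \<in> A \<Longrightarrow> x \<in> gen_monoid A"
  unfolding gen_monoid_def by (rule image_eqI[of _ _ "[x]"]) auto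

lemma gen_monoid_add: "x \<in> gen_monoid A \<Longrightarrow> y \<in> gen_monoid A \<Longrightarrow> x + y \<in> gen_monoid A"
  unfolding gen_monoid_def by (auto intro!: image_eqI[of _ _ "_ @ _"])

lemma gen_monoid_nonneg:
  fixes A :: "'g::linordered_ab_group_add set"
  assumes "A \<subseteq> {0..}"
  shows "gen_monoid A \<subseteq> {0..}"
  using assms unfolding gen_monoid_def by (auto intro!: sum_list_nonneg)

lemma countable_gen_monoid: "countable A \<Longrightarrow> countable (gen_monoid A)"
  unfolding gen_monoid_def by (intro countable_image countable_lists)

text \<open>The embedding pairs each letter t of \<open>u\<close> with a letter s \<ge> t of
  \<open>w\<close>. An unpaired letter of \<open>w\<close> contributes an element of
  \<open>S\<close>, a pair contributes 0 or s - t. What matters is that only letters of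
  \<open>u\<close> are ever subtracted, whatever \<open>w\<close> is.\<close>

lemma list_emb_sum_diff:
  fixes S :: "'g::linordered_ab_group_add set"
  assumes "list_emb (\<le>) u w" "w \<in> lists S"
  shows "sum_list w - sum_list u \<in> gen_monoid (S \<union> (\<Union>t\<in>set u. {s - t |s. s \<in> S \<and> t < s}))"
  using assms
proof (induction rule: list_emb.induct)
  case (list_emb_Nil ys)
  then show ?case by (auto simp: gen_monoid_def)
next
  case (list_emb_Cons xs ys y)
  then have "y + (sum_list ys - sum_list xs) \<in> gen_monoid (S \<union> (\<Union>t\<in>set xs. {s - t |s. s \<in> S \<and> t < s}))"
    by (intro gen_monoid_add) (auto intro: gen_monoid_incl)
  then show ?case by (simp add: algebra_simps)
next
  case (list_emb_Cons2 x y xs ys)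
  let ?A = "S \<union> (\<Union>t\<in>set (x # xs). {s - t |s. s \<in> S \<and> t < s})"
  have "y - x \<in> gen_monoid ?A"
  proof (cases "x = y")
    case True then show ?thesis by (simp add: gen_monoid_zero)
  next
    case False
    then have "x < y" "y \<in> S" using list_emb_Cons2 by auto
    then show ?thesis by (intro gen_monoid_incl) auto
  qed
  moreover have "sum_list ys - sum_list xs \<in> gen_monoid ?A"
    using list_emb_Cons2 by (intro subsetD[OF gen_monoid_mono list_emb_Cons2.IH]) auto
  ultimately have "(y - x) + (sum_list ys - sum_list xs) \<in> gen_monoid ?A" by (rule gen_monoid_add)
  then show ?case by (simp add: algebra_simps)
qed

lemma list_emb_sum_le:
  fixes u w :: "'g::linordered_ab_group_add list"
  assumes "list_emb (\<le>) u w" "w \<in> lists {0..}"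
  shows "sum_list u \<le> sum_list w"
  using assms
proof (induction rule: list_emb.induct)
  case (list_emb_Nil ys) then show ?case by (auto intro: sum_list_nonneg)
next
  case (list_emb_Cons xs ys y) then show ?case by (auto intro: add_increasing)
next
  case (list_emb_Cons2 x y xs ys) then show ?case by (auto intro: add_mono)
qed

text \<open>Sums increase along embeddings of words with nonnegative letters, so the minimum of
  \<open>B\<close> is attained on a finite basis of the words whose sum lies in
  \<open>B\<close>.\<close>

lemma gen_monoid_well_ordered:
  fixes S :: "'g::linordered_ab_group_add set"
  assumes wo: "well_ordered_set S" and S: "S \<subseteq> {0..}"
  shows "well_ordered_set (gen_monoid S)"
  unfolding well_ordered_set_def
proof (intro allI impI)
  fix B assume B: "B \<subseteq> gen_monoid S" "B \<noteq> {}"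
  define U where "U = {w \<in> lists S. sum_list w \<in> B}"
  obtain V where V: "finite V" "V \<subseteq> U" "\<And>w. w \<in> U \<Longrightarrow> \<exists>u\<in>V. list_emb (\<le>) u w"
    by (rule list_emb_finite_basis[OF wo, of U]) (auto simp: U_def)
  have B_eq: "B = sum_list ` U" using B(1) by (auto simp: U_def gen_monoid_def)
  then have "V \<noteq> {}" using V(3) B(2) by blast
  have "Min (sum_list ` V) \<le> b" if "b \<in> B" for b
  proof -
    obtain w where w: "w \<in> U" "b = sum_list w" using \<open>b \<in> B\<close> unfolding B_eq by (rule imageE) blast
    obtain u where u: "u \<in> V" "list_emb (\<le>) u w" using V(3) w by blast
    have "w \<in> lists {0..}" using w S lists_mono[OF S] by (auto simp: U_def)
    then have "sum_list u \<le> b" using list_emb_sum_le u w by blast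
    moreover have "Min (sum_list ` V) \<le> sum_list u" using V u by simp
    ultimately show ?thesis by order
  qed
  moreover have "Min (sum_list ` V) \<in> B"
    using Min_in[of "sum_list ` V"] V \<open>V \<noteq> {}\<close> B_eq by blast
  ultimately show "\<exists>m\<in>B. \<forall>b\<in>B. m \<le> b" by blast
qed

section \<open>Admissible sets of exponents\<close>


lemma weakly_monotonous_subset:
  "weakly_monotonous Y e B \<Longrightarrow> A \<subseteq> B \<Longrightarrow> weakly_monotonous Y e A"
  unfolding weakly_monotonous_def by (meson subsetD)

lemma admissible_set_subset:
  assumes "admissible_set Y e S" "T \<subseteq> S"
  shows "admissible_set Y e T"
  unfolding admissible_set_def Let_def
proof (intro conjI allI impI)
  show "T \<subseteq> {0..}" "well_ordered_set T" "weakly_monotonous Y e T"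
    using assms weakly_monotonous_subset[of Y e S T] well_ordered_set_subset[of S T] unfolding admissible_set_def by auto
next
  fix B assume "B \<subseteq> T" "B \<noteq> {}"
  then have "weakly_monotonous Y e {\<alpha> - (LEAST b. b \<in> B) |\<alpha>. \<alpha> \<in> S \<and> \<alpha> > (LEAST b. b \<in> B)}"
    using assms unfolding admissible_set_def Let_def by (meson subset_trans)
  then show "weakly_monotonous Y e {\<alpha> - (LEAST b. b \<in> B) |\<alpha>. \<alpha> \<in> T \<and> \<alpha> > (LEAST b. b \<in> B)}"
    by (rule weakly_monotonous_subset) (use \<open>T \<subseteq> S\<close> in auto)
qed

section \<open>The topology at the added point\<close>

lemma lzero_notin_logcover: "lzero \<notin> logcover"
  by (simp add: lzero_def logcover_def)

lemma openin_ldisc: "\<epsilon> > 0 \<Longrightarrow> openin logcover0_topology (ldisc \<epsilon>)"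
  unfolding logcover0_topology_def openin_topology_generated_by_iff
  by (rule generate_topology_on.Basis) auto

text \<open>Since the topology is given by generators, its open sets are reached by induction on
  their generation. The outcome is that it is Euclidean away from 0 and that the discs form a
  neighbourhood base at 0; the discs are nested, so an intersection takes the smaller
  radius.\<close>

lemma openin_logcover0_topologyD:
  assumes "openin logcover0_topology T"
  shows "open (T \<inter> logcover) \<and> (lzero \<in> T \<longrightarrow> (\<exists>\<epsilon>>0. ldisc \<epsilon> \<subseteq> T))"
  using assms unfolding logcover0_topology_def openin_topology_generated_by_iff
proof (induction rule: generate_topology_on.induct)
  case Empty
  then show ?case by simp
next
  case (Int a b)
  have "open (a \<inter> logcover \<inter> (b \<inter> logcover))" using Int.IH by (auto intro: open_Int[of "a \<inter> logcover" "b \<inter> logcover"] simp del: open_Int)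
  also have "a \<inter> logcover \<inter> (b \<inter> logcover) = a \<inter> b \<inter> logcover" by blast
  finally have "open (a \<inter> b \<inter> logcover)" .
  moreover have "\<exists>\<epsilon>>0. ldisc \<epsilon> \<subseteq> a \<inter> b" if zero: "lzero \<in> a \<inter> b"
  proof -
    obtain \<epsilon>1 \<epsilon>2 where "\<epsilon>1 > 0" "ldisc \<epsilon>1 \<subseteq> a" "\<epsilon>2 > 0" "ldisc \<epsilon>2 \<subseteq> b"
      using Int.IH zero by blast
    then have "min \<epsilon>1 \<epsilon>2 > 0" "ldisc (min \<epsilon>1 \<epsilon>2) \<subseteq> a \<inter> b" by (auto simp: ldisc_def)
    then show ?thesis by blast
  qed
  ultimately show ?case by blast
next
  case (UN K)
  have "\<Union>K \<inter> logcover = (\<Union>k\<in>K. k \<inter> logcover)" by blast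
  moreover have "open (\<Union>k\<in>K. k \<inter> logcover)" using UN.IH by (intro open_UN) auto
  moreover have "\<exists>\<epsilon>>0. ldisc \<epsilon> \<subseteq> \<Union>K" if "lzero \<in> \<Union>K"
    using that UN.IH by (meson Union_iff Union_upper subset_trans)
  ultimately show ?case by simp
next
  case (Basis s)
  have "open (ldisc \<epsilon> \<inter> logcover)" for \<epsilon>
  proof -
    have "ldisc \<epsilon> \<inter> logcover = {0<..<\<epsilon>} \<times> UNIV"
      by (auto simp: ldisc_def logcover_def lzero_def)
    then show ?thesis by (simp add: open_Times)
  qed
  moreover have "U \<inter> logcover = U" if "U \<subseteq> logcover" for U using that by blast
  ultimately show ?case using Basis lzero_notin_logcover by auto
qed

section \<open>Size of the exponents on small discs\<close>

locale exponent_family =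
  fixes Y :: "lpoint set" and e :: "'g::linordered_ab_group_add \<Rightarrow> lpoint \<Rightarrow> complex"
  assumes dom: "log_domain Y" and hom: "exponent_hom Y e"
begin

lemma open_Y: "open Y" and lzero_notin: "lzero \<notin> Y"
  using dom lzero_notin_logcover unfolding log_domain_def by blast+

lemma posreal_in_Y: obtains \<delta> where "\<delta> > 0" "\<And>x. 0 < x \<Longrightarrow> x < \<delta> \<Longrightarrow> posreal x \<in> Y"
  using dom that unfolding log_domain_def image_subset_iff by force

lemma posreal_in_ldisc: "0 < x \<Longrightarrow> x < \<epsilon> \<Longrightarrow> posreal x \<in> ldisc \<epsilon>"
  by (simp add: posreal_def ldisc_def logcover_def)

text \<open>A real supremum over the empty set is unspecified, so upper bounds for
  \<open>esup\<close> rest on this. The point comes from the piece of the positive axis inside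
  \<open>Y\<close>.\<close>

lemma ldisc_nonempty:
  assumes "\<epsilon> > 0" shows "Y \<inter> ldisc \<epsilon> \<noteq> {}"
proof -
  obtain \<delta> where \<delta>: "\<delta> > 0" "\<And>x. 0 < x \<Longrightarrow> x < \<delta> \<Longrightarrow> posreal x \<in> Y" using posreal_in_Y by blast
  then have "posreal (min \<epsilon> \<delta> / 2) \<in> Y \<inter> ldisc \<epsilon>"
    using assms by (auto intro!: posreal_in_ldisc simp: min_def)
  then show ?thesis by blast
qed

lemma ldisc_mono: "\<rho> \<le> \<epsilon> \<Longrightarrow> ldisc \<rho> \<subseteq> ldisc \<epsilon>"
  by (auto simp: ldisc_def)

lemma e_nonzero: "z \<in> Y \<Longrightarrow> e \<gamma> z \<noteq> 0"
  and e_add: "z \<in> Y \<Longrightarrow> e (\<gamma> + \<gamma>') z = e \<gamma> z * e \<gamma>' z"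
  using hom unfolding exponent_hom_def by blast+

lemma e_zero: "z \<in> Y \<Longrightarrow> e 0 z = 1"
  using e_add[of z 0 0] e_nonzero[of z 0] by simp

lemma e_sum_list: "z \<in> Y \<Longrightarrow> e (sum_list w) z = (\<Prod>\<gamma>\<leftarrow>w. e \<gamma> z)"
  by (induction w) (auto simp: e_zero e_add)

lemma bounded_e: "\<gamma> \<ge> 0 \<Longrightarrow> bounded (e \<gamma> ` Y)"
proof (cases "\<gamma> = 0")
  case True
  then have "e \<gamma> ` Y \<subseteq> {1}" by (auto simp: e_zero)
  then show ?thesis by (rule bounded_subset[rotated]) simp
next
  case False
  assume "\<gamma> \<ge> 0"
  then show ?thesis using False hom unfolding exponent_hom_def by (metis less_le)
qed

lemma e_le_esup:
  assumes "\<gamma> \<ge> 0" "z \<in> Y" "z \<in> ldisc \<epsilon>" shows "cmod (e \<gamma> z) \<le> esup Y e \<epsilon> \<gamma>"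
proof -
  obtain C where "\<forall>z\<in>Y. cmod (e \<gamma> z) \<le> C" using bounded_e[OF assms(1)] by (auto simp: bounded_iff)
  then show ?thesis unfolding esup_def using assms by (intro cSUP_upper bdd_aboveI2[of _ _ C]) auto
qed

lemma esup_least:
  assumes "\<epsilon> > 0" "\<And>z. z \<in> Y \<Longrightarrow> z \<in> ldisc \<epsilon> \<Longrightarrow> cmod (e \<gamma> z) \<le> C"
  shows "esup Y e \<epsilon> \<gamma> \<le> C"
  unfolding esup_def using assms ldisc_nonempty by (intro cSUP_least) auto

lemma esup_nonneg:
  assumes "\<epsilon> > 0" "\<gamma> \<ge> 0" shows "esup Y e \<epsilon> \<gamma> \<ge> 0"
proof -
  obtain z where "z \<in> Y" "z \<in> ldisc \<epsilon>" using ldisc_nonempty[OF assms(1)] by blast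
  then show ?thesis using e_le_esup[OF assms(2)] norm_ge_zero order_trans by blast
qed

lemma esup_mono: "0 < \<rho> \<Longrightarrow> \<rho> \<le> \<epsilon> \<Longrightarrow> \<gamma> \<ge> 0 \<Longrightarrow> esup Y e \<rho> \<gamma> \<le> esup Y e \<epsilon> \<gamma>"
  by (rule esup_least) (use ldisc_mono[of \<rho> \<epsilon>] in \<open>auto intro: e_le_esup\<close>)

lemma esup_sum_list:
  assumes "\<epsilon> > 0" "w \<in> lists {0..}"
  shows "esup Y e \<epsilon> (sum_list w) \<le> (\<Prod>\<gamma>\<leftarrow>w. esup Y e \<epsilon> \<gamma>)"
proof (rule esup_least[OF assms(1)])
  fix z assume z: "z \<in> Y" "z \<in> ldisc \<epsilon>"
  have "cmod (\<Prod>\<gamma>\<leftarrow>w. e \<gamma> z) \<le> (\<Prod>\<gamma>\<leftarrow>w. esup Y e \<epsilon> \<gamma>)"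
    using assms(2)
  proof (induction w)
    case (Cons \<gamma> w)
    then show ?case
      using z assms(1) by (auto simp: norm_mult intro!: mult_mono e_le_esup esup_nonneg)
  qed simp
  then show "cmod (e (sum_list w) z) \<le> (\<Prod>\<gamma>\<leftarrow>w. esup Y e \<epsilon> \<gamma>)" using z by (simp add: e_sum_list)
qed

text \<open>The limit at 0 is taken in the topology whose neighbourhoods of 0 contain discs, so it
  yields a bound on a whole disc, uniformly in the argument.\<close>

lemma e_small:
  assumes "\<gamma> > 0" "\<eta> > 0"
  obtains \<epsilon> where "\<epsilon> > 0" "\<And>z. z \<in> Y \<Longrightarrow> z \<in> ldisc \<epsilon> \<Longrightarrow> cmod (e \<gamma> z) < \<eta>"
proof -
  have "eventually (\<lambda>z. cmod (e \<gamma> z) < \<eta>) (atin_within logcover0_topology lzero Y)"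
    using hom assms order_tendstoD(2) unfolding exponent_hom_def by blast
  moreover have "lzero \<in> topspace logcover0_topology"
    using openin_subset[OF openin_ldisc[of 1]] by (auto simp: ldisc_def)
  ultimately obtain T where T: "openin logcover0_topology T" "lzero \<in> T"
    "\<forall>z\<in>T. z \<in> Y \<and> z \<noteq> lzero \<longrightarrow> cmod (e \<gamma> z) < \<eta>"
    unfolding eventually_atin_within by blast
  then obtain \<epsilon> where "\<epsilon> > 0" "ldisc \<epsilon> \<subseteq> T" using openin_logcover0_topologyD by blast
  then show thesis using T lzero_notin that by (metis subsetD)
qed

lemma tendsto_esup:
  assumes "\<gamma> > 0" shows "((\<lambda>\<epsilon>. esup Y e \<epsilon> \<gamma>) \<longlongrightarrow> 0) (at_right 0)"
proof (rule tendstoI)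
  fix \<eta> :: real assume "\<eta> > 0"
  then obtain \<epsilon> where \<epsilon>: "\<epsilon> > 0" "\<And>z. z \<in> Y \<Longrightarrow> z \<in> ldisc \<epsilon> \<Longrightarrow> cmod (e \<gamma> z) < \<eta> / 2"
    using e_small[of \<gamma> "\<eta> / 2"] assms by auto
  have "dist (esup Y e \<rho> \<gamma>) 0 < \<eta>" if "\<rho> > 0" "\<rho> < \<epsilon>" for \<rho>
  proof -
    have "esup Y e \<rho> \<gamma> \<le> \<eta> / 2"
      using that \<epsilon>(2) ldisc_mono[of \<rho> \<epsilon>] by (intro esup_least) (auto intro: less_imp_le)
    then show ?thesis using esup_nonneg[of \<rho> \<gamma>] that assms \<open>\<eta> > 0\<close> by auto
  qed
  then show "eventually (\<lambda>\<epsilon>. dist (esup Y e \<epsilon> \<gamma>) 0 < \<eta>) (at_right 0)"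
    using \<epsilon>(1) by (auto simp: eventually_at_right_field)
qed

text \<open>For \<gamma> > 0 the value at \<open>posreal x\<close> is nonzero while
  \<open>e \<gamma>\<close> tends to 0, so some smaller disc stays below it; for \<gamma> = 0 both
  sides are 1. The radius depends on \<gamma>, so the argument reaches finitely many exponents at a
  time.\<close>

lemma weakly_monotonous_singleton:
  assumes "\<gamma> \<ge> 0" shows "weakly_monotonous Y e {\<gamma>}"
proof -
  obtain \<delta> where \<delta>: "\<delta> > 0" "\<And>x. 0 < x \<Longrightarrow> x < \<delta> \<Longrightarrow> posreal x \<in> Y" using posreal_in_Y by blast
  have "\<exists>\<rho>>0. \<rho> \<le> x \<and> esup Y e \<rho> \<gamma> \<le> cmod (e \<gamma> (posreal x))" if x: "0 < x" "x < \<delta>" for x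
  proof (cases "\<gamma> = 0")
    case True
    then have "esup Y e x \<gamma> \<le> 1" using x by (intro esup_least) (auto simp: e_zero)
    then show ?thesis using True x \<delta>(2)[OF x] by (intro exI[of _ x]) (simp add: e_zero)
  next
    case False
    have "cmod (e \<gamma> (posreal x)) > 0" using \<delta>(2)[OF x] e_nonzero by simp
    then obtain \<epsilon> where \<epsilon>: "\<epsilon> > 0"
      "\<And>z. z \<in> Y \<Longrightarrow> z \<in> ldisc \<epsilon> \<Longrightarrow> cmod (e \<gamma> z) < cmod (e \<gamma> (posreal x))"
      using e_small[of \<gamma>] assms False by (metis less_le)
    have "esup Y e (min \<epsilon> x) \<gamma> \<le> cmod (e \<gamma> (posreal x))"
      using \<epsilon> x ldisc_mono[of "min \<epsilon> x" \<epsilon>] by (intro esup_least) (auto intro: less_imp_le)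
    then show ?thesis using \<epsilon>(1) x by (intro exI[of _ "min \<epsilon> x"]) auto
  qed
  then show ?thesis unfolding weakly_monotonous_def using \<delta>(1) by (intro exI[of _ \<delta>]) simp
qed

text \<open>The smaller of the two radii serves both families, as \<open>esup\<close> grows with the
  radius on nonnegative exponents.\<close>

lemma weakly_monotonous_Un:
  assumes "weakly_monotonous Y e A" "weakly_monotonous Y e B" "A \<union> B \<subseteq> {0..}"
  shows "weakly_monotonous Y e (A \<union> B)"
proof -
  obtain r where r: "r > 0" "\<forall>x. 0 < x \<and> x < r \<longrightarrow>
      (\<exists>\<rho>. 0 < \<rho> \<and> \<rho> \<le> x \<and> (\<forall>\<alpha>\<in>A. esup Y e \<rho> \<alpha> \<le> cmod (e \<alpha> (posreal x))))"
    using assms(1) unfolding weakly_monotonous_def by (elim exE conjE)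
  obtain s where s: "s > 0" "\<forall>x. 0 < x \<and> x < s \<longrightarrow>
      (\<exists>\<rho>. 0 < \<rho> \<and> \<rho> \<le> x \<and> (\<forall>\<alpha>\<in>B. esup Y e \<rho> \<alpha> \<le> cmod (e \<alpha> (posreal x))))"
    using assms(2) unfolding weakly_monotonous_def by (elim exE conjE)
  have "\<exists>\<rho>. 0 < \<rho> \<and> \<rho> \<le> x \<and> (\<forall>\<alpha>\<in>A \<union> B. esup Y e \<rho> \<alpha> \<le> cmod (e \<alpha> (posreal x)))"
    if x: "0 < x" "x < min r s" for x
  proof -
    obtain \<rho> where \<rho>: "0 < \<rho>" "\<rho> \<le> x" "\<forall>\<alpha>\<in>A. esup Y e \<rho> \<alpha> \<le> cmod (e \<alpha> (posreal x))"
      using r(2) x by (metis min_less_iff_conj)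
    obtain \<sigma> where \<sigma>: "0 < \<sigma>" "\<sigma> \<le> x" "\<forall>\<alpha>\<in>B. esup Y e \<sigma> \<alpha> \<le> cmod (e \<alpha> (posreal x))"
      using s(2) x by (metis min_less_iff_conj)
    have "esup Y e (min \<rho> \<sigma>) \<alpha> \<le> cmod (e \<alpha> (posreal x))" if "\<alpha> \<in> A \<union> B" for \<alpha>
      using that
    proof
      have \<alpha>: "\<alpha> \<ge> 0" using that assms(3) by auto
      show ?thesis if "\<alpha> \<in> A"
        using that \<rho> \<sigma> \<alpha> esup_mono[of "min \<rho> \<sigma>" \<rho> \<alpha>] by (auto intro: order_trans)
      show ?thesis if "\<alpha> \<in> B"
        using that \<rho> \<sigma> \<alpha> esup_mono[of "min \<rho> \<sigma>" \<sigma> \<alpha>] by (auto intro: order_trans)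
    qed
    then show ?thesis using \<rho> \<sigma> by (intro exI[of _ "min \<rho> \<sigma>"]) auto
  qed
  then show ?thesis unfolding weakly_monotonous_def using r(1) s(1) by (intro exI[of _ "min r s"]) auto
qed

lemma weakly_monotonous_UN:
  assumes "finite I" "\<And>i. i \<in> I \<Longrightarrow> weakly_monotonous Y e (A i)" "\<And>i. i \<in> I \<Longrightarrow> A i \<subseteq> {0..}"
  shows "weakly_monotonous Y e (\<Union>i\<in>I. A i)"
  using assms
proof (induction I rule: finite_induct)
  case empty
  have "\<exists>\<rho>>0. \<rho> \<le> x" if "0 < x" for x :: real using that by blast
  then show ?case unfolding weakly_monotonous_def by (intro exI[of _ 1]) simp
next
  case (insert i I)
  then have "weakly_monotonous Y e (A i \<union> (\<Union>i\<in>I. A i))"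
    by (intro weakly_monotonous_Un) auto
  then show ?case by simp
qed

text \<open>A radius that is good for the letters is good for all words, whatever their length: the
  supremum of a product is at most the product of the suprema, whereas at the single point
  \<open>posreal x\<close> the absolute values multiply exactly. The latter requires
  \<open>posreal x\<close> to lie in \<open>Y\<close>, whence the second bound on x.\<close>

lemma weakly_monotonous_gen_monoid:
  assumes "weakly_monotonous Y e A" "A \<subseteq> {0..}"
  shows "weakly_monotonous Y e (gen_monoid A)"
proof -
  obtain r where r: "r > 0" "\<forall>x. 0 < x \<and> x < r \<longrightarrow>
      (\<exists>\<rho>. 0 < \<rho> \<and> \<rho> \<le> x \<and> (\<forall>\<alpha>\<in>A. esup Y e \<rho> \<alpha> \<le> cmod (e \<alpha> (posreal x))))"
    using assms(1) unfolding weakly_monotonous_def by (elim exE conjE)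
  obtain \<delta> where \<delta>: "\<delta> > 0" "\<And>x. 0 < x \<Longrightarrow> x < \<delta> \<Longrightarrow> posreal x \<in> Y" using posreal_in_Y by blast
  have "\<exists>\<rho>. 0 < \<rho> \<and> \<rho> \<le> x \<and> (\<forall>\<alpha>\<in>gen_monoid A. esup Y e \<rho> \<alpha> \<le> cmod (e \<alpha> (posreal x)))"
    if x: "0 < x" "x < min r \<delta>" for x
  proof -
    obtain \<rho> where \<rho>: "0 < \<rho>" "\<rho> \<le> x" "\<forall>\<alpha>\<in>A. esup Y e \<rho> \<alpha> \<le> cmod (e \<alpha> (posreal x))"
      using r(2) x by (metis min_less_iff_conj)
    have "esup Y e \<rho> (sum_list w) \<le> cmod (e (sum_list w) (posreal x))" if "w \<in> lists A" for w
    proof -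
      have w: "w \<in> lists {0..}" using that lists_mono[OF assms(2)] by blast
      have "(\<Prod>\<gamma>\<leftarrow>w. esup Y e \<rho> \<gamma>) \<le> cmod (\<Prod>\<gamma>\<leftarrow>w. e \<gamma> (posreal x))"
        using that w
      proof (induction w rule: list.induct)
        case (Cons \<gamma> w)
        have "(\<Prod>\<gamma>\<leftarrow>w. esup Y e \<rho> \<gamma>) \<ge> 0"
          using Cons.prems(2) \<rho>(1) by (induction w) (auto intro!: mult_nonneg_nonneg esup_nonneg)
        then show ?case using Cons \<rho> by (auto simp: norm_mult intro!: mult_mono)
      qed simp
      then show ?thesis
        using esup_sum_list[OF \<rho>(1) w] \<delta>(2)[of x] x by (simp add: e_sum_list)
    qed
    then show ?thesis using \<rho> by (auto simp: gen_monoid_def)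
  qed
  then show ?thesis
    unfolding weakly_monotonous_def using r(1) \<delta>(1) by (intro exI[of _ "min r \<delta>"]) auto
qed

text \<open>By Higman's lemma, the words over \<open>S\<close> with sum above \<open>m\<close> all dominate one of finitely
  many such words, so that their differences with \<open>m\<close> are sums of elements of a finite set, of
  elements of \<open>S\<close>, and of differences \<open>s - t\<close> with \<open>t\<close> from a finite subset of \<open>S\<close>.\<close>

lemma weakly_monotonous_gen_monoid_diff:
  assumes adm: "admissible_set Y e S"
  shows "weakly_monotonous Y e {\<alpha> - m |\<alpha>. \<alpha> \<in> gen_monoid S \<and> \<alpha> > m}"
proof -
  have S: "S \<subseteq> {0..}" "well_ordered_set S" "weakly_monotonous Y e S"
    using adm by (simp_all only: admissible_set_def)
  define D where "D t = {s - t |s. s \<in> S \<and> t < s}" for t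
  have D_mono: "weakly_monotonous Y e (D t)" if "t \<in> S" for t
  proof -
    \<comment> \<open>The condition on subsets B is invoked for singletons, whose minimum is the
      prescribed t.\<close>
    have "(LEAST b. b \<in> {t}) = t" by (rule Least_equality) auto
    moreover from adm have "\<forall>B\<subseteq>S. B \<noteq> {} \<longrightarrow>
        weakly_monotonous Y e {\<alpha> - (LEAST b. b \<in> B) |\<alpha>. \<alpha> \<in> S \<and> (LEAST b. b \<in> B) < \<alpha>}"
      unfolding admissible_set_def Let_def by (elim conjE)
    then have "{t} \<subseteq> S \<longrightarrow> {t} \<noteq> {} \<longrightarrow>
        weakly_monotonous Y e {\<alpha> - (LEAST b. b \<in> {t}) |\<alpha>. \<alpha> \<in> S \<and> (LEAST b. b \<in> {t}) < \<alpha>}"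
      by (rule spec)
    ultimately show ?thesis using that unfolding D_def by simp
  qed
  define U where "U = {w \<in> lists S. sum_list w > m}"
  obtain V where V: "finite V" "V \<subseteq> U" "\<And>w. w \<in> U \<Longrightarrow> \<exists>u\<in>V. list_emb (\<le>) u w"
    by (rule list_emb_finite_basis[OF S(2), of U]) (auto simp: U_def)
  define T where "T = (\<Union>u\<in>V. set u)"
  have T: "finite T" "T \<subseteq> S" using V(1,2) by (auto simp: T_def U_def)
  define A where "A = (\<Union>u\<in>V. {sum_list u - m}) \<union> (S \<union> (\<Union>t\<in>T. D t))"
  have A: "A \<subseteq> {0..}" using V(2) S(1) by (auto simp: A_def U_def D_def)
  have "weakly_monotonous Y e A"
    unfolding A_def
  proof (intro weakly_monotonous_Un weakly_monotonous_UN V(1) T(1) S(3))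
    show "weakly_monotonous Y e {sum_list u - m}" if "u \<in> V" for u
      using that V(2) by (intro weakly_monotonous_singleton) (auto simp: U_def)
    show "weakly_monotonous Y e (D t)" if "t \<in> T" for t
      using that T(2) by (intro D_mono) auto
  qed (use A in \<open>auto simp: A_def\<close>)
  then have "weakly_monotonous Y e (gen_monoid A)"
    using A by (rule weakly_monotonous_gen_monoid)
  moreover have "{\<alpha> - m |\<alpha>. \<alpha> \<in> gen_monoid S \<and> \<alpha> > m} \<subseteq> gen_monoid A"
  proof
    fix \<beta> assume "\<beta> \<in> {\<alpha> - m |\<alpha>. \<alpha> \<in> gen_monoid S \<and> \<alpha> > m}"
    then obtain w where w: "w \<in> U" "\<beta> = sum_list w - m" by (auto simp: gen_monoid_def U_def)
    obtain u where u: "u \<in> V" "list_emb (\<le>) u w" using V(3) w(1) by blast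
    have "sum_list w - sum_list u \<in> gen_monoid (S \<union> (\<Union>t\<in>set u. D t))"
      using u(2) w(1) unfolding D_def U_def by (intro list_emb_sum_diff) auto
    also have "\<dots> \<subseteq> gen_monoid A"
      using u(1) by (intro gen_monoid_mono) (auto simp: A_def T_def)
    finally have "(sum_list u - m) + (sum_list w - sum_list u) \<in> gen_monoid A"
      using u(1) by (intro gen_monoid_add[OF gen_monoid_incl]) (auto simp: A_def)
    then show "\<beta> \<in> gen_monoid A" using w(2) by simp
  qed
  ultimately show ?thesis by (rule weakly_monotonous_subset)
qed

lemma admissible_set_gen_monoid:
  assumes "admissible_set Y e S" shows "admissible_set Y e (gen_monoid S)"
proof -
  have "S \<subseteq> {0..}" "well_ordered_set S" "weakly_monotonous Y e S"
    using assms by (simp_all only: admissible_set_def)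
  then show ?thesis
    unfolding admissible_set_def Let_def
    by (intro conjI allI impI gen_monoid_nonneg gen_monoid_well_ordered weakly_monotonous_gen_monoid
        weakly_monotonous_gen_monoid_diff assms)
qed

end

section \<open>Sums over words\<close>


lemma prod_list_map_mult:
  fixes p q :: "'b \<Rightarrow> real"
  shows "(\<Prod>x\<leftarrow>w. p x * q x) = (\<Prod>x\<leftarrow>w. p x) * (\<Prod>x\<leftarrow>w. q x)"
  by (induction w) auto

lemma prod_list_map_nonneg:
  fixes p :: "'b \<Rightarrow> real"
  shows "(\<And>x. x \<in> set w \<Longrightarrow> p x \<ge> 0) \<Longrightarrow> (\<Prod>x\<leftarrow>w. p x) \<ge> 0"
  by (induction w) auto

lemma norm_prod_list_map_le:
  fixes u :: "'b \<Rightarrow> 'a::real_normed_algebra_1"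
  assumes "\<And>x. x \<in> set w \<Longrightarrow> norm (u x) \<le> p x"
  shows "norm (\<Prod>x\<leftarrow>w. u x) \<le> (\<Prod>x\<leftarrow>w. p x)"
  using assms
proof (induction w)
  case (Cons x w)
  have "norm (u x * (\<Prod>x\<leftarrow>w. u x)) \<le> norm (u x) * norm (\<Prod>x\<leftarrow>w. u x)" by (rule norm_mult_ineq)
  also have "\<dots> \<le> p x * (\<Prod>x\<leftarrow>w. p x)"
    using Cons order_trans[OF norm_ge_zero] by (intro mult_mono) auto
  finally show ?case by simp
qed simp

lemma norm_prod_list_map:
  fixes u :: "'b \<Rightarrow> 'a::real_normed_div_algebra"
  shows "norm (\<Prod>x\<leftarrow>w. u x) = (\<Prod>x\<leftarrow>w. norm (u x))"
  by (induction w) (auto simp: norm_mult)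

lemma lists_eq_insert_Nil: "lists A = insert [] ((\<lambda>(x, w). x # w) ` (A \<times> lists A))"
proof -
  have "w \<in> lists A \<longleftrightarrow> w \<in> insert [] ((\<lambda>(x, w). x # w) ` (A \<times> lists A))" for w
    by (cases w) auto
  then show ?thesis by blast
qed

text \<open>Splitting off the first letter turns the sum s_n over words of length at most n in a
  finite alphabet into s_(n+1) = 1 + (sum of \<open>p\<close>) * s_n. The bound 1 / (1 - q) is the
  fixed point of t \<mapsto> 1 + q t, so it survives the induction and depends neither on the
  alphabet nor on n.\<close>

lemma summable_on_lists_prod_list:
  fixes p :: "'b \<Rightarrow> real"
  assumes nonneg: "\<And>x. x \<in> A \<Longrightarrow> p x \<ge> 0" and sum: "p summable_on A" and less: "infsum p A < 1"
  shows "(\<lambda>w. \<Prod>x\<leftarrow>w. p x) summable_on lists A"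
proof (rule nonneg_bdd_above_summable_on)
  show "(\<Prod>x\<leftarrow>w. p x) \<ge> 0" if "w \<in> lists A" for w
    using that nonneg by (intro prod_list_map_nonneg) auto
  define q where "q = infsum p A"
  have q: "0 \<le> q" "q < 1" using less nonneg by (auto simp: q_def intro: infsum_nonneg)
  \<comment> \<open>Finiteness is carried through the induction because \<open>sum\<close> is 0 by
    default on infinite sets.\<close>
  have bound: "finite {w. set w \<subseteq> B \<and> length w \<le> n} \<and>
      (\<Sum>w | set w \<subseteq> B \<and> length w \<le> n. \<Prod>x\<leftarrow>w. p x) \<le> 1 / (1 - q)"
    if B: "finite B" "B \<subseteq> A" for B n
  proof (induction n)
    case 0
    have "{w. set w \<subseteq> B \<and> length w \<le> 0} = {[]}" by auto
    then show ?case using q by simp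
  next
    case (Suc n)
    let ?L = "\<lambda>n. {w. set w \<subseteq> B \<and> length w \<le> n}"
    have "w \<in> ?L (Suc n) \<longleftrightarrow> w \<in> insert [] ((\<lambda>(x, w). x # w) ` (B \<times> ?L n))" for w
      by (cases w) auto
    then have L_Suc: "?L (Suc n) = insert [] ((\<lambda>(x, w). x # w) ` (B \<times> ?L n))" by blast
    have fin: "finite (?L n)" using Suc by blast
    have "(\<Sum>w\<in>?L (Suc n). \<Prod>x\<leftarrow>w. p x) = 1 + (\<Sum>w\<in>(\<lambda>(x, w). x # w) ` (B \<times> ?L n). \<Prod>x\<leftarrow>w. p x)"
      unfolding L_Suc using fin B(1) by (subst sum.insert) auto
    also have "(\<Sum>w\<in>(\<lambda>(x, w). x # w) ` (B \<times> ?L n). \<Prod>x\<leftarrow>w. p x) =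
        (\<Sum>(x, w)\<in>B \<times> ?L n. p x * (\<Prod>x\<leftarrow>w. p x))"
      by (subst sum.reindex) (auto simp: inj_on_def intro!: sum.cong)
    also have "\<dots> = (\<Sum>x\<in>B. p x) * (\<Sum>w\<in>?L n. \<Prod>x\<leftarrow>w. p x)"
      by (simp add: sum_product sum.cartesian_product)
    also have "\<dots> \<le> q * (1 / (1 - q))"
    proof (rule mult_mono)
      show "(\<Sum>x\<in>B. p x) \<le> q"
        unfolding q_def using B nonneg sum by (intro finite_sum_le_infsum) auto
      show "0 \<le> (\<Sum>w\<in>?L n. \<Prod>x\<leftarrow>w. p x)"
        using B(2) nonneg by (intro sum_nonneg prod_list_map_nonneg) auto
    qed (use Suc q in auto)
    also have "1 + q * (1 / (1 - q)) = 1 / (1 - q)" using q by (simp add: field_simps)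
    finally show ?case using L_Suc fin B(1) by simp
  qed
  show "bdd_above (sum (\<lambda>w. \<Prod>x\<leftarrow>w. p x) ` {F. F \<subseteq> lists A \<and> finite F})"
  proof (rule bdd_aboveI2)
    fix F assume F: "F \<in> {F. F \<subseteq> lists A \<and> finite F}"
    \<comment> \<open>For empty \<open>F\<close> the value of \<open>Max\<close> is unspecified, but
      the inclusion below is then trivial.\<close>
    define B n where "B = (\<Union>w\<in>F. set w)" and "n = Max (length ` F)"
    have B: "finite B" "B \<subseteq> A" using F by (auto simp: B_def)
    have "F \<subseteq> {w. set w \<subseteq> B \<and> length w \<le> n}" using F by (auto simp: B_def n_def)
    then have "(\<Sum>w\<in>F. \<Prod>x\<leftarrow>w. p x) \<le> (\<Sum>w | set w \<subseteq> B \<and> length w \<le> n. \<Prod>x\<leftarrow>w. p x)"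
      using bound[OF B, of n] B(2) nonneg by (intro sum_mono2 prod_list_map_nonneg) auto
    then show "(\<Sum>w\<in>F. \<Prod>x\<leftarrow>w. p x) \<le> 1 / (1 - q)" using bound[OF B, of n] by linarith
  qed
qed

text \<open>The geometric series in a noncommutative algebra. The products of \<open>p\<close>
  majorise the terms, so the sum over words may be regrouped by first letter, giving W = 1 + (sum of
  \<open>u\<close>) * W. The first letter stands on the left, so W appears as a right
  inverse.\<close>

lemma infsum_lists_prod_list:
  fixes u :: "'b \<Rightarrow> 'a::{real_normed_algebra_1, banach}"
  assumes u: "\<And>x. x \<in> A \<Longrightarrow> norm (u x) \<le> p x"
    and p: "p summable_on A" "infsum p A < 1"
  shows "(\<lambda>w. \<Prod>x\<leftarrow>w. u x) summable_on lists A"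
    and "(1 - infsum u A) * (\<Sum>\<^sub>\<infinity>w\<in>lists A. \<Prod>x\<leftarrow>w. u x) = 1"
proof -
  define P where "P w = (\<Prod>x\<leftarrow>w. u x)" for w
  have p_nonneg: "p x \<ge> 0" if "x \<in> A" for x using u[OF that] norm_ge_zero order_trans by blast
  have "(\<lambda>w. \<Prod>x\<leftarrow>w. p x) summable_on lists A"
    using p by (intro summable_on_lists_prod_list p_nonneg)
  then have "(\<lambda>w. norm (P w)) summable_on lists A"
    unfolding P_def
    by (rule Infinite_Sum.abs_summable_on_comparison_test') (use u in \<open>auto intro: norm_prod_list_map_le\<close>)
  then show summable: "P summable_on lists A" unfolding P_def by (rule abs_summable_summable)
  have u_summable: "u summable_on A"
    using Infinite_Sum.abs_summable_on_comparison_test'[OF p(1) u] by (rule abs_summable_summable)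
  let ?C = "(\<lambda>(x, w). x # w) ` (A \<times> lists A)"
  have inj: "inj_on (\<lambda>(x, w). x # w) (A \<times> lists A)" by (auto simp: inj_on_def)
  have P_C: "P \<circ> (\<lambda>(x, w). x # w) = (\<lambda>(x, w). u x * P w)" by (auto simp: P_def)
  have C: "P summable_on ?C"
    using summable by (rule summable_on_subset_banach) auto
  then have "(\<lambda>(x, w). u x * P w) summable_on A \<times> lists A"
    by (simp only: summable_on_reindex[OF inj] P_C)
  then have "(\<Sum>\<^sub>\<infinity>(x, w)\<in>A \<times> lists A. u x * P w) = (\<Sum>\<^sub>\<infinity>x\<in>A. \<Sum>\<^sub>\<infinity>w\<in>lists A. u x * P w)"
    by (rule infsum_Sigma'_banach[symmetric])
  also have "\<dots> = infsum u A * infsum P (lists A)"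
    using summable u_summable by (simp add: infsum_cmult_right infsum_cmult_left)
  finally have "infsum P ?C = infsum u A * infsum P (lists A)"
    by (simp only: infsum_reindex[OF inj] P_C)
  moreover have "infsum P (insert [] ?C) = P [] + infsum P ?C"
    using C by (intro infsum_insert) auto
  ultimately have "infsum P (lists A) = 1 + infsum u A * infsum P (lists A)"
    by (metis P_def lists_eq_insert_Nil list.map(1) prod_list.Nil)
  then show "(1 - infsum u A) * infsum P (lists A) = 1" by (simp add: algebra_simps)
qed

text \<open>Summation over L is rewritten as a double sum over the pairs (\<sigma> x, x);
  completeness makes each fibre summable. With \<sigma> = \<open>sum_list\<close> this collects the
  words of equal sum.\<close>

lemma has_sum_fibres:
  fixes f :: "'b \<Rightarrow> 'a::banach"
  assumes "f summable_on L"
  shows "((\<lambda>y. infsum f {x \<in> L. \<sigma> x = y}) has_sum infsum f L) (\<sigma> ` L)"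
proof -
  have bij: "bij_betw snd (Sigma (\<sigma> ` L) (\<lambda>y. {x \<in> L. \<sigma> x = y})) L"
    by (rule bij_betw_byWitness[where f' = "\<lambda>x. (\<sigma> x, x)"]) auto
  have "(f has_sum infsum f L) L" using assms by (rule has_sum_infsum)
  then have "((\<lambda>yx. f (snd yx)) has_sum infsum f L) (Sigma (\<sigma> ` L) (\<lambda>y. {x \<in> L. \<sigma> x = y}))"
    by (simp only: has_sum_reindex_bij_betw[OF bij])
  then show ?thesis
  proof (rule has_sum_SigmaD)
    fix y
    have "f summable_on {x \<in> L. \<sigma> x = y}"
      using assms by (rule summable_on_subset_banach) auto
    then show "((\<lambda>x. f (snd (y, x))) has_sum infsum f {x \<in> L. \<sigma> x = y}) {x \<in> L. \<sigma> x = y}"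
      by simp
  qed
qed

section \<open>Complex scalars and the coefficients of the inverse series\<close>

lemma bounded_linear_scaleC: "bounded_linear (\<lambda>x::'a::complex_banach_algebra_1. c *\<^sub>C x)"
proof (rule bounded_linear_intro)
  show "c *\<^sub>C (x + y) = c *\<^sub>C x + c *\<^sub>C y" for x y :: 'a by (rule scaleC_add_right)
  show "c *\<^sub>C (r *\<^sub>R x) = r *\<^sub>R (c *\<^sub>C x)" for r and x :: 'a
    by (simp add: scaleC_of_real[symmetric] scaleC_scaleC mult.commute)
  show "norm (c *\<^sub>C x) \<le> norm x * cmod c" for x :: 'a by (simp add: norm_scaleC)
qed

lemma scaleC_one: "1 *\<^sub>C x = (x::'a::complex_banach_algebra_1)"
  using scaleC_of_real[of 1 x] by simp

lemma scaleC_zero: "c *\<^sub>C 0 = (0::'a::complex_banach_algebra_1)"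
  by (rule linear_0[OF bounded_linear.linear[OF bounded_linear_scaleC]])

lemma prod_list_scaleC:
  fixes c :: "'b \<Rightarrow> 'a::complex_banach_algebra_1"
  shows "(\<Prod>x\<leftarrow>w. k x *\<^sub>C c x) = (\<Prod>x\<leftarrow>w. k x) *\<^sub>C (\<Prod>x\<leftarrow>w. c x)"
  by (induction w) (auto simp: scaleC_one mult_scaleC_left mult_scaleC_right scaleC_scaleC mult.commute)

text \<open>The coefficients of \<open>(1 - \<Sum>\<gamma>\<in>A. c\<^sub>\<gamma> e\<^sub>\<gamma>)\<^sup>-\<^sup>1\<close>.\<close>

definition neumann_coeff :: "'g::monoid_add set \<Rightarrow> ('g \<Rightarrow> 'a) \<Rightarrow> 'g \<Rightarrow> 'a::complex_banach_algebra_1"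
  where "neumann_coeff A c \<beta> = (\<Sum>\<^sub>\<infinity>w\<in>{w \<in> lists A. sum_list w = \<beta>}. \<Prod>\<gamma>\<leftarrow>w. c \<gamma>)"

lemma neumann_coeff_eq_0: "\<beta> \<notin> gen_monoid A \<Longrightarrow> neumann_coeff A c \<beta> = 0"
proof -
  assume "\<beta> \<notin> gen_monoid A"
  then have "{w \<in> lists A. sum_list w = \<beta>} = {}" by (auto simp: gen_monoid_def)
  then show ?thesis by (simp only: neumann_coeff_def infsum_empty)
qed

context exponent_family
begin

context
  fixes A :: "'g set" and c :: "'g \<Rightarrow> 'a::complex_banach_algebra_1" and \<epsilon> :: real
  assumes A: "A \<subseteq> {0..}" and \<epsilon>: "\<epsilon> > 0"
    and c_summable: "(\<lambda>\<gamma>. norm (c \<gamma>) * esup Y e \<epsilon> \<gamma>) summable_on A"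
    and c_less: "(\<Sum>\<^sub>\<infinity>\<gamma>\<in>A. norm (c \<gamma>) * esup Y e \<epsilon> \<gamma>) < 1"
begin

lemma term_le:
  assumes "z \<in> Y" "z \<in> ldisc \<epsilon>" "\<gamma> \<in> A"
  shows "norm (e \<gamma> z *\<^sub>C c \<gamma>) \<le> norm (c \<gamma>) * esup Y e \<epsilon> \<gamma>"
  using e_le_esup[of \<gamma> z \<epsilon>] assms subsetD[OF A] by (auto simp: norm_scaleC mult.commute intro: mult_left_mono)

text \<open>Since \<open>esup\<close> is submultiplicative, a word w with sum \<beta> satisfies
  \<open>N w * esup Y e \<epsilon> \<beta> \<le> P w\<close>. Summing over the fibre of \<beta>
  bounds the term of \<beta>, and the fibre sums of \<open>P\<close> are summable because
  \<open>P\<close> is summable over all words.\<close>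

lemma neumann_coeff_summable: "(\<lambda>\<beta>. norm (neumann_coeff A c \<beta>) * esup Y e \<epsilon> \<beta>) summable_on gen_monoid A"
proof -
  define P where "P w = (\<Prod>\<gamma>\<leftarrow>w. norm (c \<gamma>) * esup Y e \<epsilon> \<gamma>)" for w
  define N where "N w = (\<Prod>\<gamma>\<leftarrow>w. norm (c \<gamma>))" for w
  have P: "P summable_on lists A"
    unfolding P_def using c_summable c_less A \<epsilon> esup_nonneg
    by (intro summable_on_lists_prod_list) (auto intro!: mult_nonneg_nonneg)
  \<comment> \<open>Nothing assumed here makes the fibres finite, so even the series defining a
    single coefficient needs a convergence proof. At a fixed point z all words with sum \<beta>
    share the nonzero factor \<open>e \<beta> z\<close>; dividing by it bounds \<open>N\<close> by a
    multiple of \<open>P\<close>.\<close>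
  obtain z where z: "z \<in> Y" "z \<in> ldisc \<epsilon>" using ldisc_nonempty[OF \<epsilon>] by blast
  let ?F = "\<lambda>\<beta>. {w \<in> lists A. sum_list w = \<beta>}"
  have P_fibre: "P summable_on ?F \<beta>" for \<beta>
    using P by (rule summable_on_subset_banach) auto
  have N_nonneg: "N w \<ge> 0" for w unfolding N_def by (intro prod_list_map_nonneg) auto
  have N_summable: "N summable_on ?F \<beta>" for \<beta>
  proof -
    have "norm (N w) \<le> inverse (cmod (e \<beta> z)) * P w" if "w \<in> ?F \<beta>" for w
    proof -
      have "cmod (e \<beta> z) * N w = (\<Prod>\<gamma>\<leftarrow>w. norm (e \<gamma> z *\<^sub>C c \<gamma>))"
        using that z(1)
        by (auto simp: e_sum_list N_def norm_scaleC prod_list_map_mult norm_prod_list_map)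
      also have "\<dots> \<le> P w"
        unfolding P_def
        by (rule order_trans[OF abs_ge_self norm_prod_list_map_le[where 'a = real, unfolded real_norm_def]])
          (use that term_le[OF z] in auto)
      finally show ?thesis using N_nonneg[of w] e_nonzero[OF z(1), of \<beta>] by (simp add: field_simps)
    qed
    then have "(\<lambda>w. norm (N w)) summable_on ?F \<beta>"
      by (rule Infinite_Sum.abs_summable_on_comparison_test'[OF summable_on_cmult_right[OF P_fibre]])
    then show ?thesis by (rule abs_summable_summable)
  qed
  have le: "norm (neumann_coeff A c \<beta>) * esup Y e \<epsilon> \<beta> \<le> infsum P (?F \<beta>)" if "\<beta> \<in> gen_monoid A" for \<beta>
  proof -
    have esup_\<beta>: "esup Y e \<epsilon> \<beta> \<ge> 0"
      using that gen_monoid_nonneg[OF A] \<epsilon> by (intro esup_nonneg) auto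
    have c_N: "norm (\<Prod>\<gamma>\<leftarrow>w. c \<gamma>) \<le> N w" for w
      unfolding N_def by (rule norm_prod_list_map_le) simp
    have "norm (neumann_coeff A c \<beta>) \<le> infsum N (?F \<beta>)"
      unfolding neumann_coeff_def
      using abs_summable_summable[OF Infinite_Sum.abs_summable_on_comparison_test'[OF N_summable c_N]] c_N
      by (intro norm_infsum_le[OF has_sum_infsum has_sum_infsum[OF N_summable]]) auto
    then have "norm (neumann_coeff A c \<beta>) * esup Y e \<epsilon> \<beta> \<le> infsum N (?F \<beta>) * esup Y e \<epsilon> \<beta>"
      using esup_\<beta> by (rule mult_right_mono)
    also have "\<dots> = (\<Sum>\<^sub>\<infinity>w\<in>?F \<beta>. N w * esup Y e \<epsilon> \<beta>)"
      using N_summable by (simp add: infsum_cmult_left)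
    also have "\<dots> \<le> infsum P (?F \<beta>)"
    proof (rule infsum_mono)
      show "(\<lambda>w. N w * esup Y e \<epsilon> \<beta>) summable_on ?F \<beta>"
        using N_summable by (rule summable_on_cmult_left)
      show "P summable_on ?F \<beta>" by (rule P_fibre)
      fix w assume w: "w \<in> ?F \<beta>"
      then have "w \<in> lists {0..}" using lists_mono[OF A] by blast
      from esup_sum_list[OF \<epsilon> this]
      have "N w * esup Y e \<epsilon> \<beta> \<le> N w * (\<Prod>\<gamma>\<leftarrow>w. esup Y e \<epsilon> \<gamma>)"
        using w N_nonneg by (intro mult_left_mono) auto
      then show "N w * esup Y e \<epsilon> \<beta> \<le> P w" by (simp add: P_def N_def prod_list_map_mult)
    qed
    finally show ?thesis .
  qed
  have "(\<lambda>\<beta>. infsum P (?F \<beta>)) summable_on gen_monoid A"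
    using has_sum_fibres[OF P, of sum_list] unfolding gen_monoid_def by (rule has_sum_imp_summable)
  then show ?thesis
  proof (rule summable_on_comparison_test)
    show "0 \<le> norm (neumann_coeff A c \<beta>) * esup Y e \<epsilon> \<beta>" if "\<beta> \<in> gen_monoid A" for \<beta>
      using that gen_monoid_nonneg[OF A] \<epsilon> by (intro mult_nonneg_nonneg esup_nonneg) auto
  qed (use le in auto)
qed

lemma neumann_series:
  assumes z: "z \<in> Y" "z \<in> ldisc \<epsilon>"
  obtains h where "((\<lambda>\<beta>. e \<beta> z *\<^sub>C neumann_coeff A c \<beta>) has_sum h) (gen_monoid A)"
    and "(1 - (\<Sum>\<^sub>\<infinity>\<gamma>\<in>A. e \<gamma> z *\<^sub>C c \<gamma>)) * h = 1"
proof -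
  define P where "P w = (\<Prod>\<gamma>\<leftarrow>w. e \<gamma> z *\<^sub>C c \<gamma>)" for w
  let ?F = "\<lambda>\<beta>. {w \<in> lists A. sum_list w = \<beta>}"
  note sums = infsum_lists_prod_list[OF term_le[OF z] c_summable c_less, folded P_def]
  have fibre: "infsum P (?F \<beta>) = e \<beta> z *\<^sub>C neumann_coeff A c \<beta>" for \<beta>
  proof -
    have nz: "e \<beta> z \<noteq> 0" using z(1) by (rule e_nonzero)
    have "P summable_on ?F \<beta>" using sums(1) by (rule summable_on_subset_banach) auto
    then have "(P has_sum infsum P (?F \<beta>)) (?F \<beta>)" by (rule has_sum_infsum)
    \<comment> \<open>Summability over the fibre is known for the terms evaluated at z. Dividing by
      their common factor \<open>e \<beta> z\<close> transfers it to the bare products of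
      coefficients.\<close>
    then have "((\<lambda>w. inverse (e \<beta> z) *\<^sub>C P w) has_sum inverse (e \<beta> z) *\<^sub>C infsum P (?F \<beta>)) (?F \<beta>)"
      by (rule has_sum_bounded_linear[OF bounded_linear_scaleC])
    moreover have "inverse (e \<beta> z) *\<^sub>C P w = (\<Prod>\<gamma>\<leftarrow>w. c \<gamma>)" if "w \<in> ?F \<beta>" for w
    proof -
      have "P w = e \<beta> z *\<^sub>C (\<Prod>\<gamma>\<leftarrow>w. c \<gamma>)"
        using that z(1) by (auto simp: P_def prod_list_scaleC e_sum_list)
      then show ?thesis using nz by (simp add: scaleC_scaleC scaleC_one)
    qed
    ultimately have "((\<lambda>w. \<Prod>\<gamma>\<leftarrow>w. c \<gamma>) has_sum inverse (e \<beta> z) *\<^sub>C infsum P (?F \<beta>)) (?F \<beta>)"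
      by (rule has_sum_cong[THEN iffD1, rotated])
    then have "neumann_coeff A c \<beta> = inverse (e \<beta> z) *\<^sub>C infsum P (?F \<beta>)"
      unfolding neumann_coeff_def by (rule infsumI)
    then show ?thesis using nz by (simp add: scaleC_scaleC scaleC_one)
  qed
  have "((\<lambda>\<beta>. e \<beta> z *\<^sub>C neumann_coeff A c \<beta>) has_sum infsum P (lists A)) (gen_monoid A)"
    using has_sum_fibres[OF sums(1), of sum_list] unfolding gen_monoid_def fibre .
  then show thesis using sums(2) by (rule that)
qed

end

end

section \<open>Inversion\<close>


lemma inverse_elem_eqI:
  assumes "is_inverse_of x y" shows "inverse_elem x = y"
  unfolding inverse_elem_def
proof (rule the_equality)
  fix y' assume "is_inverse_of x y'"
  have "y' = y' * (x * y)" using assms by (simp add: is_inverse_of_def)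
  also have "\<dots> = y' * x * y" by (simp only: mult.assoc)
  finally show "y' = y" using \<open>is_inverse_of x y'\<close> by (simp add: is_inverse_of_def)
qed (rule assms)

lemma inverse_elem_works:
  assumes "invertible_elem x"
  shows "x * inverse_elem x = 1" "inverse_elem x * x = 1"
  using assms inverse_elem_eqI[of x] unfolding invertible_elem_def is_inverse_of_def by auto

text \<open>This is what allows the one-sided identity of the Neumann series to identify
  f(z)^-1.\<close>

lemma inverse_elem_eq_right:
  assumes "invertible_elem x" "x * y = 1" shows "inverse_elem x = y"
proof -
  have "inverse_elem x = inverse_elem x * (x * y)" using assms by simp
  also have "\<dots> = y" using inverse_elem_works[OF assms(1)] by (simp add: mult.assoc[symmetric])
  finally show ?thesis .
qed

text \<open>Noncommutative form of 1/y - 1/x = -(y - x)/(xy); both continuity and differentiability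
  of the inverse are read off from it.\<close>

lemma inverse_elem_diff:
  fixes x y :: "'a::ring_1"
  assumes "invertible_elem x" "invertible_elem y"
  shows "inverse_elem y - inverse_elem x = - (inverse_elem y * (y - x) * inverse_elem x)"
proof -
  have "inverse_elem y * (y - x) * inverse_elem x =
      (inverse_elem y * y) * inverse_elem x - inverse_elem y * (x * inverse_elem x)"
    by (simp add: algebra_simps)
  then show ?thesis using assms by (simp add: inverse_elem_works)
qed

text \<open>The difference identity gives the bound \<open>M * norm (y - x) * K\<close>, in which M,
  the norm of the inverse of y, still varies with y. Once \<open>norm (y - x) * K\<close> is below
  1/2, the same bound yields M \<le> K + M/2, hence M \<le> 2K.\<close>

lemma continuous_on_inverse_elem:
  "continuous_on {x::'a::real_normed_algebra_1. invertible_elem x} inverse_elem"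
  unfolding continuous_on_def
proof
  fix x :: 'a assume "x \<in> {x. invertible_elem x}"
  then have x: "invertible_elem x" by simp
  let ?F = "at x within {x. invertible_elem x}"
  define K where "K = norm (inverse_elem x)"
  have lim: "((\<lambda>y. norm (y - x)) \<longlongrightarrow> 0) ?F"
    by (rule tendsto_eq_intros refl | simp)+
  have "((\<lambda>y. norm (y - x) * K) \<longlongrightarrow> 0) ?F" using tendsto_mult_left_zero[OF lim] .
  then have "\<forall>\<^sub>F y in ?F. norm (y - x) * K < 1 / 2" by (rule order_tendstoD) simp
  moreover have "\<forall>\<^sub>F y in ?F. invertible_elem y" by (simp add: eventually_at_filter)
  ultimately have "\<forall>\<^sub>F y in ?F. norm (inverse_elem y - inverse_elem x) \<le> 2 * K * norm (y - x) * K"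
  proof eventually_elim
    case (elim y)
    define M where "M = norm (inverse_elem y)"
    have K: "K \<ge> 0" and M: "M \<ge> 0" by (simp_all add: K_def M_def)
    have "norm (inverse_elem y - inverse_elem x) = norm (inverse_elem y * (y - x) * inverse_elem x)"
      using x elim(2) by (simp add: inverse_elem_diff)
    also have "\<dots> \<le> M * norm (y - x) * K"
      unfolding M_def K_def
      by (meson mult_right_mono norm_ge_zero norm_mult_ineq order_trans)
    finally have diff: "norm (inverse_elem y - inverse_elem x) \<le> M * norm (y - x) * K" .
    have "M * (norm (y - x) * K) \<le> M * (1 / 2)" using elim(1) M by (intro mult_left_mono) auto
    moreover have "M \<le> K + norm (inverse_elem y - inverse_elem x)"
      unfolding M_def K_def by (rule norm_triangle_sub)
    ultimately have "M \<le> 2 * K" using diff by (simp add: mult.assoc)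
    then have "M * norm (y - x) * K \<le> 2 * K * norm (y - x) * K"
      using K by (intro mult_right_mono) auto
    then show ?case using diff by simp
  qed
  moreover have "((\<lambda>y. 2 * K * norm (y - x) * K) \<longlongrightarrow> 0) ?F"
    using tendsto_mult_left_zero[OF tendsto_mult_right_zero[OF lim]] .
  ultimately have "((\<lambda>y. inverse_elem y - inverse_elem x) \<longlongrightarrow> 0) ?F"
    by (rule Lim_null_comparison)
  then show "(inverse_elem \<longlongrightarrow> inverse_elem x) ?F" by (rule Lim_null[THEN iffD2])
qed

lemma continuous_map_inverse_elem:
  fixes f :: "'b \<Rightarrow> 'a::real_normed_algebra_1"
  assumes "continuous_map X euclidean f" "\<And>x. x \<in> topspace X \<Longrightarrow> invertible_elem (f x)"
  shows "continuous_map X euclidean (\<lambda>x. inverse_elem (f x))"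
proof -
  have "continuous_map X (top_of_set {x. invertible_elem x}) f"
    using assms by (simp add: continuous_map_in_subtopology image_subset_iff Pi_iff)
  moreover have "continuous_map (top_of_set {x::'a. invertible_elem x}) euclidean inverse_elem"
    using continuous_on_inverse_elem by simp
  ultimately have "continuous_map X euclidean (inverse_elem \<circ> f)" by (rule continuous_map_compose)
  then show ?thesis by (simp add: o_def)
qed

text \<open>By \<open>inverse_elem_diff\<close> the difference quotient of the inverse is that of f,
  multiplied by -f(w)^-1 on the left and by f(z)^-1 on the right. Continuity of w \<mapsto> f(w)^-1
  then gives the derivative -f(z)^-1 f'(z) f(z)^-1.\<close>

lemma lholomorphic_on_inverse_elem:
  assumes f: "lholomorphic_on f Y" "continuous_on Y f" and inv: "\<And>z. z \<in> Y \<Longrightarrow> invertible_elem (f z)"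
  shows "lholomorphic_on (\<lambda>z. inverse_elem (f z)) Y"
  unfolding lholomorphic_on_def
proof
  fix z assume z: "z \<in> Y"
  define q where "q w = inverse (lproj w - lproj z)" for w
  obtain D where D: "((\<lambda>w. q w *\<^sub>C (f w - f z)) \<longlongrightarrow> D) (at z within Y)"
    using f(1) z unfolding lholomorphic_on_def q_def by blast
  have "continuous_on Y (\<lambda>z. inverse_elem (f z))"
    using inv by (intro continuous_on_compose2[OF continuous_on_inverse_elem f(2)]) auto
  then have "((\<lambda>w. inverse_elem (f w)) \<longlongrightarrow> inverse_elem (f z)) (at z within Y)"
    using z by (simp add: continuous_on_def)
  then have "((\<lambda>w. - (inverse_elem (f w) * (q w *\<^sub>C (f w - f z)) * inverse_elem (f z))) \<longlongrightarrow>
      - (inverse_elem (f z) * D * inverse_elem (f z))) (at z within Y)"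
    by (intro tendsto_intros D)
  moreover have "- (inverse_elem (f w) * (q w *\<^sub>C (f w - f z)) * inverse_elem (f z)) =
      q w *\<^sub>C (inverse_elem (f w) - inverse_elem (f z))" if "w \<in> Y" for w
  proof -
    have "q w *\<^sub>C (inverse_elem (f w) - inverse_elem (f z)) =
        q w *\<^sub>C (- (inverse_elem (f w) * (f w - f z) * inverse_elem (f z)))"
      using inverse_elem_diff[OF inv[OF z] inv[OF that]] by simp
    also have "\<dots> = - (q w *\<^sub>C (inverse_elem (f w) * (f w - f z) * inverse_elem (f z)))"
      by (rule linear_neg[OF bounded_linear.linear[OF bounded_linear_scaleC]])
    finally show ?thesis by (simp add: mult_scaleC_left mult_scaleC_right)
  qed
  then have "\<forall>\<^sub>F w in at z within Y. - (inverse_elem (f w) * (q w *\<^sub>C (f w - f z)) * inverse_elem (f z)) =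
      q w *\<^sub>C (inverse_elem (f w) - inverse_elem (f z))"
    by (simp add: eventually_at_filter)
  ultimately show "\<exists>D. ((\<lambda>w. inverse (lproj w - lproj z) *\<^sub>C
      (inverse_elem (f w) - inverse_elem (f z))) \<longlongrightarrow> D) (at z within Y)"
    unfolding q_def[symmetric] by (blast intro: Lim_transform_eventually)
qed

section \<open>Behaviour near the added point\<close>

context exponent_family
begin

text \<open>A preimage is the trace of some open \<open>T\<close>; inside \<open>Y\<close> it equals
  the trace of \<open>T \<inter> logcover\<close>, which is Euclidean open.\<close>

lemma continuous_on_Y:
  fixes f :: "lpoint \<Rightarrow> 'a::topological_space"
  assumes "continuous_map (subtopology logcover0_topology (insert lzero Y)) euclidean f"
  shows "continuous_on Y f"
  unfolding continuous_on_open_vimage[OF open_Y]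
proof (intro allI impI)
  fix V :: "'a set" assume V: "open V"
  let ?X = "subtopology logcover0_topology (insert lzero Y)"
  have topspace: "Y \<subseteq> topspace ?X"
  proof -
    have "openin logcover0_topology Y"
      unfolding logcover0_topology_def openin_topology_generated_by_iff
      by (rule generate_topology_on.Basis) (use dom in \<open>auto simp: log_domain_def\<close>)
    then show ?thesis by (auto dest: openin_subset)
  qed
  have "openin ?X {z \<in> topspace ?X. f z \<in> V}"
    using assms V by (intro openin_continuous_map_preimage) auto
  then obtain T where T: "openin logcover0_topology T"
    "{z \<in> topspace ?X. f z \<in> V} = T \<inter> insert lzero Y"
    unfolding openin_subtopology by blast
  have "f -` V \<inter> Y = (T \<inter> logcover) \<inter> Y"
    using T(2) topspace dom unfolding log_domain_def by blast
  then show "open (f -` V \<inter> Y)"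
    using openin_logcover0_topologyD[OF T(1)] open_Y by (metis open_Int)
qed

lemma near_lzero:
  fixes f :: "lpoint \<Rightarrow> 'a::metric_space"
  assumes "continuous_map (subtopology logcover0_topology (insert lzero Y)) euclidean f" "\<eta> > 0"
  obtains \<epsilon> where "\<epsilon> > 0" "\<forall>z\<in>Y \<inter> ldisc \<epsilon>. dist (f z) (f lzero) < \<eta>"
proof -
  let ?X = "subtopology logcover0_topology (insert lzero Y)"
  have zero: "lzero \<in> topspace ?X"
    using openin_subset[OF openin_ldisc[of 1]] by (auto simp: ldisc_def)
  have "openin ?X {z \<in> topspace ?X. f z \<in> ball (f lzero) \<eta>}"
    using assms(1) by (intro openin_continuous_map_preimage) auto
  then obtain T where T: "openin logcover0_topology T"
    "{z \<in> topspace ?X. f z \<in> ball (f lzero) \<eta>} = T \<inter> insert lzero Y"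
    unfolding openin_subtopology by blast
  have "lzero \<in> {z \<in> topspace ?X. f z \<in> ball (f lzero) \<eta>}" using zero \<open>\<eta> > 0\<close> by simp
  then have "lzero \<in> T" unfolding T(2) by blast
  then obtain \<epsilon> where \<epsilon>: "\<epsilon> > 0" "ldisc \<epsilon> \<subseteq> T" using openin_logcover0_topologyD[OF T(1)] by blast
  have "dist (f z) (f lzero) < \<eta>" if "z \<in> Y \<inter> ldisc \<epsilon>" for z
  proof -
    have "z \<in> T \<inter> insert lzero Y" using that \<epsilon>(2) by blast
    then show ?thesis unfolding T(2)[symmetric] by (simp add: dist_commute)
  qed
  then show thesis by (intro that[OF \<epsilon>(1)]) blast
qed

text \<open>Dominated convergence: each single term tends to 0 with the radius.\<close>

lemma small_sum_esup:
  assumes A: "A \<subseteq> {0<..}" and k: "\<And>\<gamma>. \<gamma> \<in> A \<Longrightarrow> k \<gamma> \<ge> (0::real)" and "\<delta> > 0" "\<eta> > 0"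
    and sum: "(\<lambda>\<gamma>. k \<gamma> * esup Y e \<delta> \<gamma>) summable_on A"
  obtains \<epsilon> where "0 < \<epsilon>" "\<epsilon> \<le> \<delta>" "(\<lambda>\<gamma>. k \<gamma> * esup Y e \<epsilon> \<gamma>) summable_on A"
    "(\<Sum>\<^sub>\<infinity>\<gamma>\<in>A. k \<gamma> * esup Y e \<epsilon> \<gamma>) < \<eta>"
proof -
  let ?s = "\<lambda>\<epsilon> \<gamma>. k \<gamma> * esup Y e \<epsilon> \<gamma>"
  \<comment> \<open>The terms outside \<open>F\<close> sum to at most \<eta>/3 at radius \<delta>,
    and they do not grow when the radius shrinks. So only the finitely many terms in
    \<open>F\<close> have to be made small by the choice of \<epsilon>.\<close>
  obtain F where F: "finite F" "F \<subseteq> A" "dist (sum (?s \<delta>) F) (infsum (?s \<delta>) A) \<le> \<eta> / 3"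
    using infsum_finite_approximation[OF sum, of "\<eta> / 3"] \<open>\<eta> > 0\<close> by auto
  have "((\<lambda>\<epsilon>. sum (?s \<epsilon>) F) \<longlongrightarrow> (\<Sum>\<gamma>\<in>F. k \<gamma> * 0)) (at_right 0)"
    using F(2) A by (intro tendsto_sum tendsto_mult tendsto_const tendsto_esup) auto
  then have "\<forall>\<^sub>F \<epsilon> in at_right 0. sum (?s \<epsilon>) F < \<eta> / 3"
    using \<open>\<eta> > 0\<close> by (intro order_tendstoD(2)) auto
  moreover have "\<forall>\<^sub>F \<epsilon> in at_right 0. \<epsilon> < \<delta>"
    using \<open>\<delta> > 0\<close> by (rule eventually_at_right_real[THEN eventually_mono]) simp
  moreover have "\<forall>\<^sub>F \<epsilon>::real in at_right 0. \<epsilon> > 0" by (rule eventually_at_right_less)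
  ultimately have "\<forall>\<^sub>F \<epsilon> in at_right 0. sum (?s \<epsilon>) F < \<eta> / 3 \<and> \<epsilon> < \<delta> \<and> \<epsilon> > 0"
    by eventually_elim simp
  then obtain \<epsilon> where \<epsilon>: "sum (?s \<epsilon>) F < \<eta> / 3" "\<epsilon> < \<delta>" "\<epsilon> > 0"
    using eventually_happens[of _ "at_right (0::real)"] by (auto simp: trivial_limit_at_right_real)
  have s_mono: "?s \<epsilon> \<gamma> \<le> ?s \<delta> \<gamma>" and s_nonneg: "0 \<le> ?s \<epsilon> \<gamma>" if "\<gamma> \<in> A" for \<gamma>
    using that A \<epsilon> k esup_mono[of \<epsilon> \<delta> \<gamma>] esup_nonneg[of \<epsilon> \<gamma>]
    by (auto intro!: mult_left_mono mult_nonneg_nonneg)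
  have sum_\<epsilon>: "?s \<epsilon> summable_on A"
    using sum by (rule summable_on_comparison_test) (use s_mono s_nonneg in auto)
  have split: "infsum (?s x) A = sum (?s x) F + infsum (?s x) (A - F)" if "?s x summable_on A" for x
    using that F infsum_Diff[of "?s x" A F] by simp
  have "infsum (?s \<epsilon>) (A - F) \<le> infsum (?s \<delta>) (A - F)"
    using s_mono by (intro infsum_mono summable_on_subset_banach[OF sum] summable_on_subset_banach[OF sum_\<epsilon>]) auto
  moreover have "infsum (?s \<delta>) (A - F) \<le> \<eta> / 3"
    using F(3) split[OF sum] by (auto simp: dist_real_def)
  ultimately have "infsum (?s \<epsilon>) A < \<eta>" using split[OF sum_\<epsilon>] \<epsilon>(1) \<open>\<eta> > 0\<close> by linarith
  then show thesis using \<epsilon> sum_\<epsilon> that by (simp add: less_imp_le)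
qed

text \<open>Since \<open>e 0\<close> is 1 on \<open>Y\<close>, the term of exponent 0 is
  \<open>a 0\<close>; if 0 lies outside the support, then \<open>a 0 = 0\<close> and the sum is
  unchanged.\<close>

lemma hahn_expansion_minus_const:
  fixes a :: "'g \<Rightarrow> 'a::complex_banach_algebra_1"
  assumes "z \<in> Y" "((\<lambda>\<gamma>. e \<gamma> z *\<^sub>C a \<gamma>) has_sum s) (hahn_support a)"
  shows "((\<lambda>\<gamma>. e \<gamma> z *\<^sub>C a \<gamma>) has_sum (s - a 0)) (hahn_support a - {0})"
proof (cases "0 \<in> hahn_support a")
  case True
  have "((\<lambda>\<gamma>. e \<gamma> z *\<^sub>C a \<gamma>) has_sum a 0) {0}"
    using has_sum_finite[of "{0}" "\<lambda>\<gamma>. e \<gamma> z *\<^sub>C a \<gamma>"] assms(1) by (simp add: e_zero scaleC_one)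
  then show ?thesis using assms(2) True by (intro has_sum_Diff) auto
next
  case False
  then show ?thesis using assms(2) by (simp add: hahn_support_def)
qed

text \<open>The expansion says nothing at \<open>lzero\<close> itself. A point z of \<open>Y\<close>
  in a small disc has f(z) close to \<open>a 0\<close>, as the terms of positive exponent are small
  there, and close to \<open>f lzero\<close> by continuity.\<close>

lemma hahn_holomorphic_at_lzero:
  fixes f :: "lpoint \<Rightarrow> 'a::complex_banach_algebra_1"
  assumes cont: "continuous_map (subtopology logcover0_topology (insert lzero Y)) euclidean f"
    and "\<delta> > 0" "hahn_support a \<subseteq> {0..}" "normally_convergent Y e \<delta> a"
    and f: "\<forall>z\<in>Y \<inter> ldisc \<delta>. ((\<lambda>\<gamma>. e \<gamma> z *\<^sub>C a \<gamma>) has_sum f z) (hahn_support a)"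
  shows "f lzero = a 0"
proof -
  define A where "A = hahn_support a - {0}"
  have A: "A \<subseteq> {0<..}" using assms(3) by (auto simp: A_def)
  have sum: "(\<lambda>\<gamma>. norm (a \<gamma>) * esup Y e \<delta> \<gamma>) summable_on A"
    using assms(4) unfolding normally_convergent_def A_def
    by (elim conjE) (rule summable_on_subset_banach, auto)
  have "dist (f lzero) (a 0) < \<eta>" if \<eta>: "\<eta> > 0" for \<eta>
  proof -
    obtain \<epsilon> where \<epsilon>: "0 < \<epsilon>" "\<epsilon> \<le> \<delta>" "(\<lambda>\<gamma>. norm (a \<gamma>) * esup Y e \<epsilon> \<gamma>) summable_on A"
      "(\<Sum>\<^sub>\<infinity>\<gamma>\<in>A. norm (a \<gamma>) * esup Y e \<epsilon> \<gamma>) < \<eta> / 2"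
      by (rule small_sum_esup[OF A _ \<open>\<delta> > 0\<close> _ sum, of "\<eta> / 2"]) (use \<eta> in auto)
    obtain \<epsilon>' where \<epsilon>': "\<epsilon>' > 0" "\<forall>z\<in>Y \<inter> ldisc \<epsilon>'. dist (f z) (f lzero) < \<eta> / 2"
      using near_lzero[OF cont, of "\<eta> / 2"] \<eta> by (metis half_gt_zero)
    obtain z where "z \<in> Y \<inter> ldisc (min \<epsilon> \<epsilon>')" using ldisc_nonempty[of "min \<epsilon> \<epsilon>'"] \<epsilon>(1) \<epsilon>'(1) by auto
    then have z: "z \<in> Y" "z \<in> ldisc \<epsilon>" "z \<in> ldisc \<epsilon>'" "z \<in> ldisc \<delta>"
      using ldisc_mono[of "min \<epsilon> \<epsilon>'" \<epsilon>] ldisc_mono[of "min \<epsilon> \<epsilon>'" \<epsilon>'] ldisc_mono[OF \<epsilon>(2)] by auto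
    have "((\<lambda>\<gamma>. e \<gamma> z *\<^sub>C a \<gamma>) has_sum (f z - a 0)) A"
      using hahn_expansion_minus_const[OF z(1)] f z unfolding A_def by blast
    moreover have "norm (e \<gamma> z *\<^sub>C a \<gamma>) \<le> norm (a \<gamma>) * esup Y e \<epsilon> \<gamma>" if "\<gamma> \<in> A" for \<gamma>
      using that subsetD[OF A that] e_le_esup[of \<gamma> z \<epsilon>] z by (auto simp: norm_scaleC mult.commute intro: mult_left_mono)
    ultimately have "norm (f z - a 0) \<le> (\<Sum>\<^sub>\<infinity>\<gamma>\<in>A. norm (a \<gamma>) * esup Y e \<epsilon> \<gamma>)"
      by (rule norm_infsum_le[OF _ has_sum_infsum[OF \<epsilon>(3)]])
    then have "dist (f z) (a 0) < \<eta> / 2" using \<epsilon>(4) by (simp add: dist_norm)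
    moreover have "dist (f z) (f lzero) < \<eta> / 2" using \<epsilon>'(2) z by blast
    ultimately show ?thesis by (rule dist_triangle_half_r[rotated])
  qed
  then show ?thesis by (metis dist_pos_lt less_irrefl)
qed

end

theorem theorem2p11:
  fixes Y :: "lpoint set"
    and e :: "'g::linordered_ab_group_add \<Rightarrow> lpoint \<Rightarrow> complex"
    and f :: "lpoint \<Rightarrow> 'a::complex_banach_algebra_1"
  assumes "log_domain Y"
    and "exponent_hom Y e"
    and "hahn_holomorphic Y e f"
    and "\<forall>z\<in>insert lzero Y. invertible_elem (f z)"
  shows "hahn_holomorphic Y e (\<lambda>z. inverse_elem (f z))"
proof -
  interpret exponent_family Y e by unfold_locales (fact assms)+
  have cont: "continuous_map (subtopology logcover0_topology (insert lzero Y)) euclidean f"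
    using assms(3) unfolding hahn_holomorphic_def by (elim conjE)
  have hol: "lholomorphic_on f Y"
    using assms(3) unfolding hahn_holomorphic_def by (elim conjE)
  obtain a \<delta> where adm: "admissible_set Y e (hahn_support a)" and \<delta>: "\<delta> > 0"
    and conv: "normally_convergent Y e \<delta> a"
    and expansion: "\<forall>z\<in>Y \<inter> ldisc \<delta>. ((\<lambda>\<gamma>. e \<gamma> z *\<^sub>C a \<gamma>) has_sum f z) (hahn_support a)"
    using assms(3) unfolding hahn_holomorphic_def by (elim conjE exE)
  have support: "hahn_support a \<subseteq> {0..}" "well_ordered_set (hahn_support a)"
    using adm by (simp_all only: admissible_set_def)
  have "f lzero = a 0" by (rule hahn_holomorphic_at_lzero[OF cont \<delta> support(1) conv expansion])
  define a' where "a' = inverse_elem (a 0)"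
  have a': "a 0 * a' = 1" "a' * a 0 = 1"
    using assms(4) \<open>f lzero = a 0\<close> by (simp_all add: a'_def inverse_elem_works)
  define A where "A = hahn_support a - {0}"
  have A: "A \<subseteq> {0<..}" using support(1) by (auto simp: A_def)
  then have A0: "A \<subseteq> {0..}" by auto
  \<comment> \<open>Chosen so that 1 - \<Sum> c_\<gamma> e_\<gamma> = a_0^-1 f. The factor a_0^-1
    stands on the left here and therefore on the right of the coefficients \<open>b\<close> of the
    inverse below.\<close>
  define c where "c \<gamma> = - a' * a \<gamma>" for \<gamma>
  have a_sum: "(\<lambda>\<gamma>. norm (a \<gamma>) * esup Y e \<delta> \<gamma>) summable_on A"
    using conv unfolding normally_convergent_def A_def
    by (elim conjE) (rule summable_on_subset_banach, auto)
  have c_sum: "(\<lambda>\<gamma>. norm (c \<gamma>) * esup Y e \<delta> \<gamma>) summable_on A"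
  proof (rule summable_on_comparison_test[OF summable_on_cmult_right[OF a_sum]])
    fix \<gamma> assume "\<gamma> \<in> A"
    then have esup: "esup Y e \<delta> \<gamma> \<ge> 0" using A0 \<delta> by (intro esup_nonneg) auto
    then show "0 \<le> norm (c \<gamma>) * esup Y e \<delta> \<gamma>" by simp
    have "norm (c \<gamma>) \<le> norm a' * norm (a \<gamma>)" unfolding c_def by (simp add: norm_mult_ineq)
    from mult_right_mono[OF this esup]
    show "norm (c \<gamma>) * esup Y e \<delta> \<gamma> \<le> norm a' * (norm (a \<gamma>) * esup Y e \<delta> \<gamma>)"
      by (simp add: mult.assoc)
  qed
  \<comment> \<open>The bound 1 is the convergence condition of the Neumann series. It can be met by
    shrinking the disc because exponent 0 has been removed from \<open>A\<close>.\<close>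
  obtain \<epsilon> where \<epsilon>: "0 < \<epsilon>" "\<epsilon> \<le> \<delta>" and c_sum_\<epsilon>: "(\<lambda>\<gamma>. norm (c \<gamma>) * esup Y e \<epsilon> \<gamma>) summable_on A"
    "(\<Sum>\<^sub>\<infinity>\<gamma>\<in>A. norm (c \<gamma>) * esup Y e \<epsilon> \<gamma>) < 1"
    by (rule small_sum_esup[OF A _ \<delta> _ c_sum, of 1]) auto
  define b where "b \<beta> = neumann_coeff A c \<beta> * a'" for \<beta>
  have support_b: "hahn_support b \<subseteq> gen_monoid A"
  proof
    fix \<beta> assume "\<beta> \<in> hahn_support b"
    then have "neumann_coeff A c \<beta> \<noteq> 0" by (auto simp: hahn_support_def b_def)
    then show "\<beta> \<in> gen_monoid A" using neumann_coeff_eq_0 by blast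
  qed
  have "admissible_set Y e (gen_monoid (hahn_support a))" using adm by (rule admissible_set_gen_monoid)
  moreover have "hahn_support b \<subseteq> gen_monoid (hahn_support a)"
    using support_b gen_monoid_mono[of A "hahn_support a"] by (auto simp: A_def)
  ultimately have adm_b: "admissible_set Y e (hahn_support b)" by (rule admissible_set_subset)
  then have support_b': "hahn_support b \<subseteq> {0..}" "well_ordered_set (hahn_support b)"
    by (simp_all only: admissible_set_def)
  have "countable A" using conv unfolding normally_convergent_def A_def by auto
  then have countable_b: "countable (hahn_support b)"
    using support_b countable_gen_monoid countable_subset by blast
  have b_sum: "(\<lambda>\<gamma>. norm (b \<gamma>) * esup Y e \<epsilon> \<gamma>) summable_on hahn_support b"
  proof (rule summable_on_comparison_test)
    show "(\<lambda>\<gamma>. norm (neumann_coeff A c \<gamma>) * esup Y e \<epsilon> \<gamma> * norm a') summable_on hahn_support b"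
      using neumann_coeff_summable[OF A0 \<epsilon>(1) c_sum_\<epsilon>] support_b
      by (intro summable_on_cmult_left) (rule summable_on_subset_banach)
    fix \<gamma> assume "\<gamma> \<in> hahn_support b"
    then have esup: "esup Y e \<epsilon> \<gamma> \<ge> 0" using support_b'(1) \<epsilon>(1) by (intro esup_nonneg) auto
    then show "0 \<le> norm (b \<gamma>) * esup Y e \<epsilon> \<gamma>" by simp
    have "norm (b \<gamma>) \<le> norm (neumann_coeff A c \<gamma>) * norm a'" unfolding b_def by (rule norm_mult_ineq)
    from mult_right_mono[OF this esup]
    show "norm (b \<gamma>) * esup Y e \<epsilon> \<gamma> \<le> norm (neumann_coeff A c \<gamma>) * esup Y e \<epsilon> \<gamma> * norm a'"
      by (simp add: ac_simps)
  qed
  have "bounded (e \<gamma> ` (Y \<inter> ldisc \<epsilon>))" if "\<gamma> \<in> hahn_support b" for \<gamma>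
    by (rule bounded_subset[OF bounded_e[of \<gamma>]]) (use that support_b'(1) in auto)
  then have conv_b: "normally_convergent Y e \<epsilon> b"
    unfolding normally_convergent_def using countable_b b_sum by blast
  have expansion_b: "((\<lambda>\<gamma>. e \<gamma> z *\<^sub>C b \<gamma>) has_sum inverse_elem (f z)) (hahn_support b)"
    if z: "z \<in> Y" "z \<in> ldisc \<epsilon>" for z
  proof -
    obtain h where h: "((\<lambda>\<beta>. e \<beta> z *\<^sub>C neumann_coeff A c \<beta>) has_sum h) (gen_monoid A)"
      and h_inv: "(1 - (\<Sum>\<^sub>\<infinity>\<gamma>\<in>A. e \<gamma> z *\<^sub>C c \<gamma>)) * h = 1"
      by (rule neumann_series[OF A0 \<epsilon>(1) c_sum_\<epsilon> z])
    have "z \<in> ldisc \<delta>" using z(2) ldisc_mono[OF \<epsilon>(2)] by blast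
    then have "((\<lambda>\<gamma>. e \<gamma> z *\<^sub>C a \<gamma>) has_sum (f z - a 0)) A"
      using hahn_expansion_minus_const[OF z(1)] expansion z(1) unfolding A_def by blast
    then have "((\<lambda>\<gamma>. - a' * (e \<gamma> z *\<^sub>C a \<gamma>)) has_sum (- a' * (f z - a 0))) A"
      by (rule has_sum_cmult_right)
    moreover have "- a' * (e \<gamma> z *\<^sub>C a \<gamma>) = e \<gamma> z *\<^sub>C c \<gamma>" for \<gamma>
      by (simp only: c_def mult_scaleC_right)
    ultimately have "(\<Sum>\<^sub>\<infinity>\<gamma>\<in>A. e \<gamma> z *\<^sub>C c \<gamma>) = - a' * (f z - a 0)"
      by (intro infsumI) simp
    then have "1 - (\<Sum>\<^sub>\<infinity>\<gamma>\<in>A. e \<gamma> z *\<^sub>C c \<gamma>) = a' * f z"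
      using a'(2) by (simp add: algebra_simps)
    then have "a' * (f z * h) = 1" using h_inv by (simp add: mult.assoc)
    \<comment> \<open>Multiplying by \<open>a 0\<close> on the left and by \<open>a'\<close> on the
      right moves \<open>a'\<close> from the left of \<open>f z\<close> to the right of
      \<open>h\<close>.\<close>
    then have "a 0 * (a' * (f z * h)) * a' = a 0 * a'" by simp
    then have "f z * (h * a') = 1" using a'(1) by (simp add: mult.assoc[symmetric])
    then have inverse_f: "inverse_elem (f z) = h * a'"
      using assms(4) z(1) by (intro inverse_elem_eq_right) auto
    have "((\<lambda>\<beta>. (e \<beta> z *\<^sub>C neumann_coeff A c \<beta>) * a') has_sum h * a') (gen_monoid A)"
      using h by (rule has_sum_cmult_left)
    then have "((\<lambda>\<beta>. e \<beta> z *\<^sub>C b \<beta>) has_sum h * a') (gen_monoid A)"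
      by (simp add: b_def mult_scaleC_left)
    \<comment> \<open>Cancellation between words may make the support of \<open>b\<close> smaller
      than the monoid; the terms left out are 0.\<close>
    then show ?thesis unfolding inverse_f
      by (rule has_sum_cong_neutral[THEN iffD1, rotated -1])
        (use support_b in \<open>auto simp: hahn_support_def scaleC_zero\<close>)
  qed
  have "continuous_map (subtopology logcover0_topology (insert lzero Y)) euclidean
      (\<lambda>z. inverse_elem (f z))"
    using cont by (rule continuous_map_inverse_elem) (use assms(4) in auto)
  moreover have "lholomorphic_on (\<lambda>z. inverse_elem (f z)) Y"
    using hol continuous_on_Y[OF cont] by (rule lholomorphic_on_inverse_elem) (use assms(4) in auto)
  moreover have "hahn_series b" unfolding hahn_series_def by (rule support_b'(2))
  ultimately show ?thesis
    unfolding hahn_holomorphic_def using countable_b adm_b conv_b expansion_b \<epsilon>(1)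
    by (intro conjI exI[of _ b] exI[of _ \<epsilon>] ballI) auto
qed

end
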